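(* Let $n\ge 3$. Fix $\theta_0\in\mathbb{R}^n$ and $\gamma\in\mathbb{R}_{>0}^n$ satisfying $$\det\nolimits_{\mathrm{Red}}(J(\theta_0,\gamma))=0\quad\text{and}\quad \delta(\theta_0,\gamma)<0 .$$ Fix $\sigma_0>0$ and set $\omega=\sigma_0\, g(\theta_0,\gamma)$. Then the Kuramoto model on the ring with parameters $\omega$ and $\gamma$ has a bifurcation at $(\theta,\sigma)=(\theta_0,\sigma_0)$ which involves two branches of phase-locked solutions colliding as $\sigma$ increases to $\sigma_0$. Locally (i.e. for $\sigma<\sigma_0$ sufficiently close to $\sigma_0$) one branch satisfies $\det_{\mathrm{Red}}(J(\theta,\gamma))>0$ and the other satisfies $\det_{\mathrm{Red}}(J(\theta,\gamma))<0$. In addition, let $\eta_0$ be the vector of angle differences of $\theta_0$, let $\cos\eta_0$ be the component-wise cosine, and suppose that $\cos\eta_0$ has no zero components. Let $n_+(\cos\eta_0)$ be the number of positive components of $\cos\eta_0$. Then locally, at the points $\theta$ of each branch, $$\#\{\text{positive eigenvalues of }J(\theta,\gamma)\}=n_+(\cos\eta_0)-\begin{cases}1 & \text{if }(-1)^{n-n_+(\cos\eta_0)}\det_{\mathrm{Red}}(J(\theta,\gamma))>0,\\ 0 & \text{if }(-1)^{n-n_+(\cos\eta_0)}\det_{\mathrm{Red}}(J(\theta,\gamma))<0.\end{cases}$$ In particular, if $n_+(\cos\eta_0)=n-1$, then a branch of stable phase-locked solutions collides with a branch of 1-saddles.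
   Context: Indices are taken modulo $n$. For $\theta\in\mathbb{R}^n$ the angle differences are $\eta_i=\theta_{i+1}-\theta_i$, $\eta=(\eta_1,\dots,\eta_n)$. The Kuramoto model on the ring with natural frequencies $\omega\in\mathbb{R}^n$, coupling strengths $\gamma\in\mathbb{R}_{>0}^n$ and parameter $\sigma>0$ is $$\frac{d\theta_i}{dt}=\omega_i+\sigma(\gamma_i\sin\eta_i-\gamma_{i-1}\sin\eta_{i-1}),\quad i=1,\dots,n,$$ i.e. $\frac{d\theta}{dt}=\omega-\sigma g(\theta,\gamma)$, where $g(\theta,\gamma)_i:=-\gamma_i\sin\eta_i+\gamma_{i-1}\sin\eta_{i-1}$. $J(\theta,\gamma)\in\mathbb{R}^{n\times n}$ is the Jacobian $J(\theta,\gamma)_{ij}=\partial g(\theta,\gamma)_i/\partial\theta_j$; it is symmetric and $J(\theta,\gamma)\mathbf 1=0$, where $\mathbf 1=(1,\dots,1)^\top$. Let $P$ be an $(n-1)\times n$ matrix whose rows form an orthonormal basis of $\mathbf 1^\perp$. Define $$\det\nolimits_{\mathrm{Red}}(J(\theta,\gamma)):=\det(PJ(\theta,\gamma)P^\top),$$ $$v(\theta,\gamma):=-P^\top\operatorname{adj}(PJ(\theta,\gamma)P^\top)\,P\,g(\theta,\gamma),\qquad \mathbf n(\theta,\gamma):=\nabla_\theta\det\nolimits_{\mathrm{Red}}(J(\theta,\gamma)),\qquad \delta(\theta,\gamma):=\mathbf n(\theta,\gamma)^\top v(\theta,\gamma),$$ with $\operatorname{adj}$ the adjugate matrix. (These do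 not depend on the choice of $P$.) When $\omega$ has mean zero (as is automatic for $\omega=\sigma_0 g(\theta_0,\gamma)$), a phase-locked solution at parameter $\sigma$ is a point $\theta\in\mathbb{R}^n$ with $\sigma g(\theta,\gamma)=\omega$. It is called stable if all eigenvalues of $J(\theta,\gamma)$ are positive except for one eigenvalue $0$ with eigenvector $\mathbf 1$; it is called a 1-saddle if, apart from the eigenvalue $0$ with eigenvector $\mathbf 1$, $J(\theta,\gamma)$ has exactly one negative eigenvalue and all the others are positive. "A bifurcation at $(\theta_0,\sigma_0)$ which involves two branches of phase-locked solutions colliding as $\sigma$ increases to $\sigma_0$" means: there are $\epsilon>0$ and two continuous maps $\theta_1,\theta_2:(\sigma_0-\epsilon,\sigma_0]\to\mathbb{R}^n$ (the branches) such that $\theta_k(\sigma)$ is a phase-locked solution at parameter $\sigma$ for every $\sigma$ and $k=1,2$; $\theta_1(\sigma_0)=\theta_2(\sigma_0)=\theta_0$; and for all $\sigma\in(\sigma_0-\epsilon,\sigma_0)$, $\det_{\mathrm{Red}}(J(\theta_k(\sigma),\gamma))\ne0$ for $k=1,2$ and $\theta_1(\sigma)-\theta_2(\sigma)\notin\mathbb{R}\mathbf 1$. A branch consists of stable solutions (resp. 1-saddles) if $\theta_k(\sigma)$ is stable (resp. a 1-saddle) for all $\sigma<\sigma_0$ sufficiently close to $\sigma_0$. *)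

theory Defs
  imports
    "HOL-Analysis.Derivative"
    "Jordan_Normal_Form.Char_Poly"
begin

(* Vectors in R^n and matrices are the dimension-indexed types of Jordan_Normal_Form,
   with indices 0, ..., n-1 instead of 1, ..., n. *)

definition ones :: "nat \<Rightarrow> real Matrix.vec" where
  "ones n = Matrix.vec n (\<lambda>_. 1)"

definition angle_diff :: "nat \<Rightarrow> real Matrix.vec \<Rightarrow> real Matrix.vec" where
  "angle_diff n \<theta> = Matrix.vec n (\<lambda>i. \<theta> $ ((i + 1) mod n) - \<theta> $ i)"

(* The predecessor of i modulo n is (i + n - 1) mod n, because subtraction on nat truncates. *)
definition kuramoto_g :: "nat \<Rightarrow> real Matrix.vec \<Rightarrow> real Matrix.vec \<Rightarrow> real Matrix.vec" where
  "kuramoto_g n \<gamma> \<theta> = Matrix.vec n (\<lambda>i.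
     - \<gamma> $ i * sin (angle_diff n \<theta> $ i)
     + \<gamma> $ ((i + n - 1) mod n) * sin (angle_diff n \<theta> $ ((i + n - 1) mod n)))"

(* The partial derivative of f with respect to the k-th coordinate; the vector type
   carries no topology, so it is taken along the line through x in direction e_k. *)
definition partial_deriv :: "nat \<Rightarrow> (real Matrix.vec \<Rightarrow> real) \<Rightarrow> nat \<Rightarrow> real Matrix.vec \<Rightarrow> real" where
  "partial_deriv n f k x = deriv (\<lambda>t. f (x + t \<cdot>\<^sub>v unit_vec n k)) 0"

definition partial_gradient :: "nat \<Rightarrow> (real Matrix.vec \<Rightarrow> real) \<Rightarrow> real Matrix.vec \<Rightarrow> real Matrix.vec" where
  "partial_gradient n f x = Matrix.vec n (\<lambda>k. partial_deriv n f k x)"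

definition kuramoto_jacobian :: "nat \<Rightarrow> real Matrix.vec \<Rightarrow> real Matrix.vec \<Rightarrow> real Matrix.mat" where
  "kuramoto_jacobian n \<gamma> \<theta> = Matrix.mat n n
     (\<lambda>(i, j). partial_deriv n (\<lambda>\<phi>. kuramoto_g n \<gamma> \<phi> $ i) j \<theta>)"

definition onb_ones_perp :: "nat \<Rightarrow> real Matrix.mat \<Rightarrow> bool" where
  "onb_ones_perp n P \<longleftrightarrow>
     P \<in> carrier_mat (n - 1) n \<and>
     (\<forall>i<n - 1. \<forall>j<n - 1. Matrix.row P i \<bullet> Matrix.row P j = (if i = j then 1 else 0)) \<and>
     {transpose_mat P *\<^sub>v c |c. c \<in> carrier_vec (n - 1)} = {x \<in> carrier_vec n. x \<bullet> ones n = 0}"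

(* The values below that take P as a parameter are the same for every P with onb_ones_perp n P. *)
definition det_red :: "real Matrix.mat \<Rightarrow> real Matrix.mat \<Rightarrow> real" where
  "det_red P A = Determinant.det (P * A * transpose_mat P)"

definition v_field ::
  "nat \<Rightarrow> real Matrix.mat \<Rightarrow> real Matrix.vec \<Rightarrow> real Matrix.vec \<Rightarrow> real Matrix.vec" where
  "v_field n P \<gamma> \<theta> =
     - (transpose_mat P *\<^sub>v (adj_mat (P * kuramoto_jacobian n \<gamma> \<theta> * transpose_mat P)
          *\<^sub>v (P *\<^sub>v kuramoto_g n \<gamma> \<theta>)))"

definition n_field ::
  "nat \<Rightarrow> real Matrix.mat \<Rightarrow> real Matrix.vec \<Rightarrow> real Matrix.vec \<Rightarrow> real Matrix.vec" where
  "n_field n P \<gamma> \<theta> = partial_gradient n (\<lambda>\<phi>. det_red P (kuramoto_jacobian n \<gamma> \<phi>)) \<theta>"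

definition kuramoto_delta ::
  "nat \<Rightarrow> real Matrix.mat \<Rightarrow> real Matrix.vec \<Rightarrow> real Matrix.vec \<Rightarrow> real" where
  "kuramoto_delta n P \<gamma> \<theta> = n_field n P \<gamma> \<theta> \<bullet> v_field n P \<gamma> \<theta>"

definition phase_locked ::
  "nat \<Rightarrow> real Matrix.vec \<Rightarrow> real Matrix.vec \<Rightarrow> real \<Rightarrow> real Matrix.vec \<Rightarrow> bool" where
  "phase_locked n \<omega> \<gamma> \<sigma> \<theta> \<longleftrightarrow> \<theta> \<in> carrier_vec n \<and> \<sigma> \<cdot>\<^sub>v kuramoto_g n \<gamma> \<theta> = \<omega>"

(* Real eigenvalues with algebraic multiplicity. These are all the eigenvalues of A when A
   is symmetric, as the Jacobian is. *)
definition real_eigenvalues :: "real Matrix.mat \<Rightarrow> real multiset" where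
  "real_eigenvalues A = proots (char_poly A)"

definition num_pos_eigenvalues :: "real Matrix.mat \<Rightarrow> nat" where
  "num_pos_eigenvalues A = size {#x \<in># real_eigenvalues A. x > 0#}"

definition stable_point :: "nat \<Rightarrow> real Matrix.vec \<Rightarrow> real Matrix.vec \<Rightarrow> bool" where
  "stable_point n \<gamma> \<theta> \<longleftrightarrow>
     eigenvector (kuramoto_jacobian n \<gamma> \<theta>) (ones n) 0 \<and>
     (\<forall>x \<in># real_eigenvalues (kuramoto_jacobian n \<gamma> \<theta>) - {#0#}. x > 0)"

definition one_saddle :: "nat \<Rightarrow> real Matrix.vec \<Rightarrow> real Matrix.vec \<Rightarrow> bool" where
  "one_saddle n \<gamma> \<theta> \<longleftrightarrow>
     eigenvector (kuramoto_jacobian n \<gamma> \<theta>) (ones n) 0 \<and>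
     (\<exists>\<mu> \<in># real_eigenvalues (kuramoto_jacobian n \<gamma> \<theta>) - {#0#}. \<mu> < 0 \<and>
        (\<forall>x \<in># real_eigenvalues (kuramoto_jacobian n \<gamma> \<theta>) - {#0#} - {#\<mu>#}. x > 0))"

(* Continuity of the branches is stated by components because the vector type carries no
   topology. *)
definition colliding_branches ::
  "nat \<Rightarrow> real Matrix.mat \<Rightarrow> real Matrix.vec \<Rightarrow> real Matrix.vec \<Rightarrow> real Matrix.vec \<Rightarrow> real \<Rightarrow> real \<Rightarrow>
   (real \<Rightarrow> real Matrix.vec) \<Rightarrow> (real \<Rightarrow> real Matrix.vec) \<Rightarrow> bool" where
  "colliding_branches n P \<omega> \<gamma> \<theta>0 \<sigma>0 \<epsilon> \<theta>1 \<theta>2 \<longleftrightarrow>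
     \<epsilon> > 0 \<and>
     (\<forall>\<theta> \<in> {\<theta>1, \<theta>2}.
        (\<forall>i<n. continuous_on {\<sigma>0 - \<epsilon><..\<sigma>0} (\<lambda>\<sigma>. \<theta> \<sigma> $ i)) \<and>
        (\<forall>\<sigma>\<in>{\<sigma>0 - \<epsilon><..\<sigma>0}. phase_locked n \<omega> \<gamma> \<sigma> (\<theta> \<sigma>)) \<and>
        \<theta> \<sigma>0 = \<theta>0 \<and>
        (\<forall>\<sigma>\<in>{\<sigma>0 - \<epsilon><..<\<sigma>0}. det_red P (kuramoto_jacobian n \<gamma> (\<theta> \<sigma>)) \<noteq> 0)) \<and>
     (\<forall>\<sigma>\<in>{\<sigma>0 - \<epsilon><..<\<sigma>0}. \<not> (\<exists>c. \<theta>1 \<sigma> - \<theta>2 \<sigma> = c \<cdot>\<^sub>v ones n))"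

definition num_pos_cos :: "nat \<Rightarrow> real Matrix.vec \<Rightarrow> nat" where
  "num_pos_cos n \<theta> = card {i. i < n \<and> cos (angle_diff n \<theta> $ i) > 0}"

end

theory Submission
  imports
    Defs
    "HOL-Analysis.Bounded_Continuous_Function"
    "HOL-Analysis.Henstock_Kurzweil_Integration"
    "Jordan_Normal_Form.Spectral_Radius"
begin

text \<open>
  Since \<open>J v = - det\<^sub>R\<^sub>e\<^sub>d(J) g\<close>, a solution of \<open>\<theta>' = s v(\<theta>)\<close> with \<open>s = \<plusminus> 1\<close> satisfies
  \<open>g(\<theta>(t)) = exp (- s \<integral> det\<^sub>R\<^sub>e\<^sub>d) g(\<theta>\<^sub>0)\<close>, so it is phase-locked at the parameter
  \<open>\<sigma>(t) = \<sigma>\<^sub>0 exp (s \<integral> det\<^sub>R\<^sub>e\<^sub>d)\<close>. Along it \<open>det\<^sub>R\<^sub>e\<^sub>d\<close> vanishes at \<open>t = 0\<close> with derivative \<open>s \<delta>\<close>,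
  so \<open>s det\<^sub>R\<^sub>e\<^sub>d < 0\<close> for small \<open>t > 0\<close> and \<open>\<sigma>(t)\<close> strictly decreases from \<open>\<sigma>\<^sub>0\<close>. Inverting it
  turns the two half-orbits \<open>s = \<plusminus> 1\<close> into the two branches. No nondegeneracy analysis is needed,
  and as \<open>v\<close> is a trigonometric polynomial, the flow exists by Picard's theorem.
\<close>

text \<open>Differentiating \<sigma> g(\<theta>) = \<omega> along a curve of solutions gives J
  \<theta>' = - (log \<sigma>)' g, which breaks down where J has a kernel beyond
  \<open>ones\<close>. Prescribing (log \<sigma>)' = det_Red(J) makes v a solution: the adjugate
  replaces the inverse, and the field stays smooth through the singular point. The price is that
  \<sigma> is no longer the time and is stationary at the collision, so the return from time to
  \<sigma> has to rest on continuity alone. Trigonometric polynomials suit v because determinants,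
  adjugates and partial derivatives stay in the class; this yields the chain rule and a global
  Lipschitz constant at once. The eigenvalue count is independent of the flow. J is a Laplacian of
  the cycle with weights \<gamma>_i cos \<eta>_i of either sign, and a dimension count for quadratic
  forms confines its number of positive eigenvalues to two values, between which the sign of det_Red
  decides.\<close>

unbundle no inner_syntax
unbundle no vec_syntax

subsection \<open>Lipschitz vector fields\<close>

text \<open>The flow of v will be run in a space of bounded continuous functions, so that space has
  to be admissible as the type \<open>'a\<close> of the Picard theorem.\<close>

instance bcontfun :: (metric_space, banach) banach ..

text \<open>A global Lipschitz constant makes the Picard operator a contraction on the whole
  function space, so no invariant ball around \<open>x0\<close> has to be found and the length
  \<open>h\<close> depends on \<open>L\<close> alone.\<close>

lemma picard_lindeloef_lipschitz:
  fixes f :: "'a::banach \<Rightarrow> 'a"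
  assumes lip: "\<And>x y. norm (f x - f y) \<le> L * norm (x - y)"
  obtains h x where "h > 0" "x 0 = x0"
    "\<And>t. t \<in> {0..h} \<Longrightarrow> (x has_vector_derivative f (x t)) (at t within {0..h})"
proof -
  \<comment> \<open>\<open>L\<close> may be zero or negative; this enlargement is a positive
    Lipschitz constant, by which one can divide.\<close>
  define K where "K = \<bar>L\<bar> + 1"
  have K: "K > 0" by (simp add: K_def)
  have lipK: "norm (f x - f y) \<le> K * norm (x - y)" for x y
    by (rule order_trans[OF lip mult_right_mono]) (auto simp: K_def)
  have cf: "continuous_on UNIV f"
  proof (rule continuous_on_iff[THEN iffD2], intro ballI allI impI)
    fix x :: 'a and e :: real assume "e > 0"
    have "dist (f y) (f x) < e" if "dist y x < e / K" for y
      using lipK[of y x] that K by (simp add: dist_norm field_simps)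
    thus "\<exists>d>0. \<forall>x'\<in>UNIV. dist x' x < d \<longrightarrow> dist (f x') (f x) < e"
      using \<open>e > 0\<close> K by (intro exI[of _ "e / K"]) auto
  qed
  \<comment> \<open>Over time \<open>h\<close> the operator contracts with factor
    \<open>K * h = 1/2\<close>.\<close>
  define h where "h = 1 / (2 * K)"
  have h: "h > 0" using K by (simp add: h_def)
  \<comment> \<open>The fixed point is sought among functions on the whole line, so time is clamped
    to the interval: \<open>G u\<close> is then constant on either side of \<open>{0..h}\<close> and
    bounded because its values are attained on a compact interval.\<close>
  define cl where "cl t = max 0 (min h t)" for t :: real
  have cl: "cl t \<in> {0..h}" for t using h by (auto simp: cl_def)
  have cl_id: "cl t = t" if "t \<in> {0..h}" for t using that by (auto simp: cl_def)
  have ccl: "continuous_on UNIV cl" unfolding cl_def by (intro continuous_intros)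
  define G where "G u t = x0 + integral {0..cl t} (\<lambda>s. f (apply_bcontfun u s))" for u :: "real \<Rightarrow>\<^sub>C 'a" and t
  have cfu: "continuous_on S (\<lambda>s. f (apply_bcontfun u s))" for u :: "real \<Rightarrow>\<^sub>C 'a" and S
    by (rule continuous_on_compose2[OF cf]) auto
  have ci: "continuous_on {0..h} (\<lambda>t. integral {0..t} (\<lambda>s. f (apply_bcontfun u s)))" for u :: "real \<Rightarrow>\<^sub>C 'a"
    by (rule indefinite_integral_continuous_1) (rule integrable_continuous_real[OF cfu])
  have G: "G u \<in> bcontfun" for u
  proof -
    have c: "continuous_on UNIV (G u)"
      unfolding G_def by (intro continuous_intros continuous_on_compose2[OF ci ccl]) (use cl in auto)
    have "bounded ((\<lambda>t. x0 + integral {0..t} (\<lambda>s. f (apply_bcontfun u s))) ` {0..h})"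
      by (intro compact_imp_bounded compact_continuous_image continuous_intros ci) auto
    moreover have "range (G u) \<subseteq> (\<lambda>t. x0 + integral {0..t} (\<lambda>s. f (apply_bcontfun u s))) ` {0..h}"
      using cl by (auto simp: G_def)
    ultimately show ?thesis using c bounded_subset by (auto simp: bcontfun_def)
  qed
  define \<Phi> where "\<Phi> u = Bcontfun (G u)" for u
  have \<Phi>: "apply_bcontfun (\<Phi> u) = G u" for u
    unfolding \<Phi>_def by (rule Bcontfun_inverse[OF G])
  have "\<exists>!u. \<Phi> u = u"
  proof (rule banach_fix_type[of "1/2"], safe)
    fix u v :: "real \<Rightarrow>\<^sub>C 'a"
    show "dist (\<Phi> u) (\<Phi> v) \<le> 1/2 * dist u v"
    proof (rule dist_bound)
      fix t
      have "norm (integral {0..cl t} (\<lambda>s. f (apply_bcontfun u s) - f (apply_bcontfun v s)))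
          \<le> (K * dist u v) * (cl t - 0)"
      proof (rule integral_bound)
        show "continuous_on {0..cl t} (\<lambda>s. f (apply_bcontfun u s) - f (apply_bcontfun v s))"
          by (intro continuous_intros cfu)
        fix s
        show "norm (f (apply_bcontfun u s) - f (apply_bcontfun v s)) \<le> K * dist u v"
          using lipK[of "apply_bcontfun u s" "apply_bcontfun v s"] K dist_bounded[of u s v]
          by (smt (verit, best) dist_norm mult_left_mono)
      qed (use cl in auto)
      also have "\<dots> \<le> (K * dist u v) * h"
        using cl[of t] K by (intro mult_left_mono) auto
      also have "\<dots> = 1/2 * dist u v" using K by (simp add: h_def)
      also have "integral {0..cl t} (\<lambda>s. f (apply_bcontfun u s) - f (apply_bcontfun v s)) = G u t - G v t"
        unfolding G_def
        by (subst Henstock_Kurzweil_Integration.integral_diff)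
           (auto intro: integrable_continuous_real cfu)
      finally show "dist (apply_bcontfun (\<Phi> u) t) (apply_bcontfun (\<Phi> v) t) \<le> 1/2 * dist u v"
        by (simp add: \<Phi> dist_norm)
    qed
  qed simp_all
  hence "\<exists>u. \<Phi> u = u" by (rule ex1_implies_ex)
  then obtain u where u: "\<Phi> u = u" by (rule exE)
  define x where "x = apply_bcontfun u"
  have xG: "x t = x0 + integral {0..t} (\<lambda>s. f (x s))" if "t \<in> {0..h}" for t
  proof -
    have "x t = G u t" using \<Phi>[of u, unfolded u] by (simp only: x_def)
    also have "\<dots> = x0 + integral {0..t} (\<lambda>s. f (x s))"
      using that by (simp only: G_def cl_id x_def)
    finally show ?thesis .
  qed
  have "(x has_vector_derivative f (x t)) (at t within {0..h})" if t: "t \<in> {0..h}" for t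
  proof -
    have "((\<lambda>t. x0 + integral {0..t} (\<lambda>s. f (x s))) has_vector_derivative 0 + f (x t)) (at t within {0..h})"
      by (intro derivative_intros integral_has_vector_derivative[OF _ t]) (simp add: x_def cfu)
    hence *: "((\<lambda>t. x0 + integral {0..t} (\<lambda>s. f (x s))) has_vector_derivative f (x t)) (at t within {0..h})"
      by simp
    show ?thesis
      by (rule has_vector_derivative_transform[OF t xG *])
  qed
  moreover have "x 0 = x0" using xG[of 0] h by simp
  ultimately show thesis using that[OF h, of x] by simp
qed

subsection \<open>Trigonometric polynomials\<close>

text \<open>Generating the class inductively lets bounds, Lipschitz constants and partial
  derivatives be found by induction. Only the first \<open>n\<close> coordinates are read, whatever
  the dimension of the argument.\<close>

inductive trigpoly :: "nat \<Rightarrow> (real Matrix.vec \<Rightarrow> real) \<Rightarrow> bool" for n where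
  trigpoly_const: "trigpoly n (\<lambda>_. c)"
| trigpoly_sin: "i < n \<Longrightarrow> trigpoly n (\<lambda>\<theta>. sin (\<theta> $ i))"
| trigpoly_cos: "i < n \<Longrightarrow> trigpoly n (\<lambda>\<theta>. cos (\<theta> $ i))"
| trigpoly_add: "trigpoly n f \<Longrightarrow> trigpoly n g \<Longrightarrow> trigpoly n (\<lambda>\<theta>. f \<theta> + g \<theta>)"
| trigpoly_mult: "trigpoly n f \<Longrightarrow> trigpoly n g \<Longrightarrow> trigpoly n (\<lambda>\<theta>. f \<theta> * g \<theta>)"

lemma trigpoly_uminus: "trigpoly n f \<Longrightarrow> trigpoly n (\<lambda>\<theta>. - f \<theta>)"
  using trigpoly_mult[OF trigpoly_const[of n "-1"], of f] by simp

lemma trigpoly_diff: "trigpoly n f \<Longrightarrow> trigpoly n g \<Longrightarrow> trigpoly n (\<lambda>\<theta>. f \<theta> - g \<theta>)"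
  using trigpoly_add[OF _ trigpoly_uminus, of n f g] by simp

lemma trigpoly_sum: "(\<And>x. x \<in> S \<Longrightarrow> trigpoly n (f x)) \<Longrightarrow> trigpoly n (\<lambda>\<theta>. \<Sum>x\<in>S. f x \<theta>)"
  by (induction S rule: infinite_finite_induct) (auto intro: trigpoly_const trigpoly_add)

lemma trigpoly_prod: "(\<And>x. x \<in> S \<Longrightarrow> trigpoly n (f x)) \<Longrightarrow> trigpoly n (\<lambda>\<theta>. \<Prod>x\<in>S. f x \<theta>)"
  by (induction S rule: infinite_finite_induct) (auto intro: trigpoly_const trigpoly_mult)

lemma trigpoly_cong: "trigpoly n f \<Longrightarrow> (\<And>i. i < n \<Longrightarrow> x $ i = y $ i) \<Longrightarrow> f x = f y"
  by (induction rule: trigpoly.induct) auto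

text \<open>The bound \<open>B\<close> is carried through the induction for the sake of products,
  whose Lipschitz constant \<open>L * B' + B * L'\<close> involves the bounds of the factors.
  Distance is measured in the maximum norm of the first \<open>n\<close> coordinates, through an
  upper bound \<open>d\<close>.\<close>

lemma trigpoly_bounded_lipschitz:
  assumes "trigpoly n f"
  shows "\<exists>B L. 0 \<le> L \<and> (\<forall>\<theta>. \<bar>f \<theta>\<bar> \<le> B) \<and> (\<forall>\<theta> \<theta>' d. 0 \<le> d \<longrightarrow>
    (\<forall>i<n. \<bar>\<theta> $ i - \<theta>' $ i\<bar> \<le> d) \<longrightarrow> \<bar>f \<theta> - f \<theta>'\<bar> \<le> L * d)" (is "\<exists>B L. ?P f B L")
  using assms
proof induction
  case (trigpoly_const c)
  show ?case by (intro exI[of _ "\<bar>c\<bar>"] exI[of _ 0]) auto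
next
  case (trigpoly_sin i)
  have "\<bar>sin a - sin b\<bar> \<le> \<bar>a - b\<bar>" for a b :: real
    using field_differentiable_bound[of UNIV sin cos 1 a b] by (auto intro: derivative_eq_intros)
  hence "?P (\<lambda>\<theta>. sin (\<theta> $ i)) 1 1"
    using trigpoly_sin by (auto intro: order_trans)
  thus ?case by (intro exI)
next
  case (trigpoly_cos i)
  have "\<bar>cos a - cos b\<bar> \<le> \<bar>a - b\<bar>" for a b :: real
    using field_differentiable_bound[of UNIV cos "\<lambda>x. - sin x" 1 a b] by (auto intro: derivative_eq_intros)
  hence "?P (\<lambda>\<theta>. cos (\<theta> $ i)) 1 1"
    using trigpoly_cos by (auto intro: order_trans)
  thus ?case by (intro exI)
next
  case (trigpoly_add f g)
  obtain B L where 1: "?P f B L" using trigpoly_add.IH(1) by (elim exE)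
  obtain B' L' where 2: "?P g B' L'" using trigpoly_add.IH(2) by (elim exE)
  have "?P (\<lambda>\<theta>. f \<theta> + g \<theta>) (B + B') (L + L')"
  proof (intro conjI allI impI)
    show "0 \<le> L + L'" using 1 2 by simp
    show "\<bar>f \<theta> + g \<theta>\<bar> \<le> B + B'" for \<theta>
      using conjunct1[OF conjunct2[OF 1], rule_format, of \<theta>]
        conjunct1[OF conjunct2[OF 2], rule_format, of \<theta>] by linarith
    show "\<bar>(f \<theta> + g \<theta>) - (f \<theta>' + g \<theta>')\<bar> \<le> (L + L') * d"
      if "0 \<le> d" "\<forall>i<n. \<bar>\<theta> $ i - \<theta>' $ i\<bar> \<le> d" for \<theta> \<theta>' d
      using conjunct2[OF conjunct2[OF 1], rule_format, OF that(1) that(2)[rule_format]]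
        conjunct2[OF conjunct2[OF 2], rule_format, OF that(1) that(2)[rule_format]]
      unfolding distrib_right by linarith
  qed
  thus ?case by (intro exI)
next
  case (trigpoly_mult f g)
  obtain B L where 1: "?P f B L" using trigpoly_mult.IH(1) by (elim exE)
  obtain B' L' where 2: "?P g B' L'" using trigpoly_mult.IH(2) by (elim exE)
  have f: "\<bar>f \<theta>\<bar> \<le> B" for \<theta> using 1 by simp
  have g: "\<bar>g \<theta>\<bar> \<le> B'" for \<theta> using 2 by simp
  have B: "0 \<le> B" "0 \<le> B'" using f g by (meson abs_ge_zero order_trans)+
  have L: "0 \<le> L" "0 \<le> L'" using 1 2 by simp_all
  have "?P (\<lambda>\<theta>. f \<theta> * g \<theta>) (B * B') (L * B' + B * L')"
  proof (intro conjI allI impI)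
    show "0 \<le> L * B' + B * L'" using B L by simp
    show "\<bar>f \<theta> * g \<theta>\<bar> \<le> B * B'" for \<theta>
      unfolding abs_mult by (intro mult_mono f g B) simp
    fix \<theta> \<theta>' :: "real Matrix.vec" and d :: real
    assume d: "0 \<le> d" "\<forall>i<n. \<bar>\<theta> $ i - \<theta>' $ i\<bar> \<le> d"
    have "\<bar>f \<theta> * g \<theta> - f \<theta>' * g \<theta>'\<bar> = \<bar>(f \<theta> - f \<theta>') * g \<theta> + f \<theta>' * (g \<theta> - g \<theta>')\<bar>"
      by (simp add: algebra_simps)
    also have "\<dots> \<le> \<bar>f \<theta> - f \<theta>'\<bar> * \<bar>g \<theta>\<bar> + \<bar>f \<theta>'\<bar> * \<bar>g \<theta> - g \<theta>'\<bar>"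
      by (rule order_trans[OF abs_triangle_ineq]) (simp add: abs_mult)
    also have "\<dots> \<le> (L * d) * B' + B * (L' * d)"
      using d(1) B L conjunct2[OF conjunct2[OF 1], rule_format, OF d(1) d(2)[rule_format]]
        conjunct2[OF conjunct2[OF 2], rule_format, OF d(1) d(2)[rule_format]]
      by (intro add_mono mult_mono f g) simp_all
    finally show "\<bar>f \<theta> * g \<theta> - f \<theta>' * g \<theta>'\<bar> \<le> (L * B' + B * L') * d"
      by (simp add: algebra_simps)
  qed
  thus ?case by (intro exI)
qed

text \<open>\<open>Df\<close> plays the role of the gradient of \<open>f\<close>, characterised by
  the chain rule along every curve that is differentiable coordinate by coordinate. The set
  \<open>S\<close> admits one-sided derivatives, which occur at the ends of the time interval of the
  flow.\<close>

definition partials :: "nat \<Rightarrow> (real Matrix.vec \<Rightarrow> real) \<Rightarrow> (nat \<Rightarrow> real Matrix.vec \<Rightarrow> real) \<Rightarrow> bool" where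
  "partials n f Df \<longleftrightarrow> (\<forall>c c' t S.
    (\<forall>i<n. ((\<lambda>s. c s $ i) has_real_derivative c' i) (at t within S)) \<longrightarrow>
    ((\<lambda>s. f (c s)) has_real_derivative (\<Sum>k<n. Df k (c t) * c' k)) (at t within S))"

lemma trigpoly_has_partials:
  assumes "trigpoly n f"
  shows "\<exists>Df. (\<forall>k. trigpoly n (Df k)) \<and> partials n f Df"
  using assms
proof induction
  case (trigpoly_const c)
  show ?case
    by (intro exI[of _ "\<lambda>_ _. 0"]) (auto intro: trigpoly.intros simp: partials_def)
next
  case (trigpoly_sin i)
  define Df :: "nat \<Rightarrow> real Matrix.vec \<Rightarrow> real" where "Df k \<theta> = (if k = i then cos (\<theta> $ i) else 0)" for k \<theta>
  have "trigpoly n (Df k)" for k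
    using trigpoly_sin by (cases "k = i") (auto simp: Df_def[abs_def] intro: trigpoly.intros)
  moreover have "(\<Sum>k<n. Df k \<theta> * c' k) = cos (\<theta> $ i) * c' i" for \<theta> c'
    using trigpoly_sin by (simp add: Df_def if_distrib[of "\<lambda>x. x * _"] cong: if_cong)
  moreover have "((\<lambda>s. sin (c s $ i)) has_real_derivative cos (c t $ i) * c' i) (at t within S)"
    if "\<forall>i<n. ((\<lambda>s. c s $ i) has_real_derivative c' i) (at t within S)" for c c' t S
    using DERIV_chain'[OF that[rule_format, OF trigpoly_sin] DERIV_sin] by simp
  ultimately show ?case
    by (intro exI[of _ Df]) (simp add: partials_def)
next
  case (trigpoly_cos i)
  define Df :: "nat \<Rightarrow> real Matrix.vec \<Rightarrow> real" where "Df k \<theta> = (if k = i then - sin (\<theta> $ i) else 0)" for k \<theta>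
  have "trigpoly n (Df k)" for k
    using trigpoly_cos by (cases "k = i") (auto simp: Df_def[abs_def] intro: trigpoly.intros trigpoly_uminus)
  moreover have "(\<Sum>k<n. Df k \<theta> * c' k) = - sin (\<theta> $ i) * c' i" for \<theta> c'
    using trigpoly_cos by (simp add: Df_def if_distrib[of "\<lambda>x. x * _"] cong: if_cong)
  moreover have "((\<lambda>s. cos (c s $ i)) has_real_derivative - sin (c t $ i) * c' i) (at t within S)"
    if "\<forall>i<n. ((\<lambda>s. c s $ i) has_real_derivative c' i) (at t within S)" for c c' t S
    using DERIV_chain'[OF that[rule_format, OF trigpoly_cos] DERIV_cos] by simp
  ultimately show ?case
    by (intro exI[of _ Df]) (simp add: partials_def)
next
  case (trigpoly_add f g)
  then obtain Df Dg where D: "\<forall>k. trigpoly n (Df k)" "\<forall>k. trigpoly n (Dg k)"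
    "partials n f Df" "partials n g Dg"
    by blast
  have "((\<lambda>s. f (c s) + g (c s)) has_real_derivative
      (\<Sum>k<n. (Df k (c t) + Dg k (c t)) * c' k)) (at t within S)"
    if "\<forall>i<n. ((\<lambda>s. c s $ i) has_real_derivative c' i) (at t within S)" for c c' t S
    using DERIV_add[OF D(3)[unfolded partials_def, rule_format, OF that[rule_format]] D(4)[unfolded partials_def, rule_format, OF that[rule_format]]] by (simp add: distrib_right sum.distrib)
  hence p: "partials n (\<lambda>\<theta>. f \<theta> + g \<theta>) (\<lambda>k \<theta>. Df k \<theta> + Dg k \<theta>)"
    unfolding partials_def by (intro allI impI)
  have "trigpoly n (\<lambda>\<theta>. Df k \<theta> + Dg k \<theta>)" for k
    using D(1,2) by (intro trigpoly.trigpoly_add) auto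
  with p show ?case by (intro exI[of _ "\<lambda>k \<theta>. Df k \<theta> + Dg k \<theta>"] conjI allI)
next
  case (trigpoly_mult f g)
  then obtain Df Dg where D: "\<forall>k. trigpoly n (Df k)" "\<forall>k. trigpoly n (Dg k)"
    "partials n f Df" "partials n g Dg"
    by blast
  have "((\<lambda>s. f (c s) * g (c s)) has_real_derivative
      (\<Sum>k<n. (Df k (c t) * g (c t) + Dg k (c t) * f (c t)) * c' k)) (at t within S)"
    if "\<forall>i<n. ((\<lambda>s. c s $ i) has_real_derivative c' i) (at t within S)" for c c' t S
  proof -
    have "(\<Sum>k<n. (Df k (c t) * g (c t) + Dg k (c t) * f (c t)) * c' k) =
        (\<Sum>k<n. Df k (c t) * c' k) * g (c t) + (\<Sum>k<n. Dg k (c t) * c' k) * f (c t)"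
      unfolding sum_distrib_right sum.distrib[symmetric]
      by (rule sum.cong) (simp_all add: algebra_simps)
    thus ?thesis
      using DERIV_mult[OF D(3)[unfolded partials_def, rule_format, OF that[rule_format]]
          D(4)[unfolded partials_def, rule_format, OF that[rule_format]]] by (simp only:)
  qed
  hence p: "partials n (\<lambda>\<theta>. f \<theta> * g \<theta>) (\<lambda>k \<theta>. Df k \<theta> * g \<theta> + Dg k \<theta> * f \<theta>)"
    unfolding partials_def by (intro allI impI)
  have "trigpoly n (\<lambda>\<theta>. Df k \<theta> * g \<theta> + Dg k \<theta> * f \<theta>)" for k
    using D(1,2) trigpoly_mult.hyps by (intro trigpoly.trigpoly_add trigpoly.trigpoly_mult) auto
  with p show ?case by (intro exI[of _ "\<lambda>k \<theta>. Df k \<theta> * g \<theta> + Dg k \<theta> * f \<theta>"] conjI allI)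
qed

text \<open>Testing the chain rule on coordinate lines identifies the witnesses of
  \<open>trigpoly_has_partials\<close> with \<open>partial_deriv\<close>, so Jacobian entries and
  gradients inherit what is known about the witnesses.\<close>

lemma trigpoly_partial_deriv_chain:
  assumes "trigpoly n f"
  shows "k < n \<Longrightarrow> trigpoly n (partial_deriv n f k)"
    and "(\<And>i. i < n \<Longrightarrow> ((\<lambda>s. c s $ i) has_real_derivative c' i) (at t within S)) \<Longrightarrow>
      ((\<lambda>s. f (c s)) has_real_derivative (\<Sum>k<n. partial_deriv n f k (c t) * c' k)) (at t within S)"
proof -
  obtain Df where Df: "\<And>k. trigpoly n (Df k)" "partials n f Df"
    using trigpoly_has_partials[OF assms] by blast
  have eq: "partial_deriv n f k x = Df k (x + 0 \<cdot>\<^sub>v unit_vec n k)" if "k < n" for k x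
  proof -
    have "((\<lambda>s. f (x + s \<cdot>\<^sub>v unit_vec n k)) has_real_derivative
        (\<Sum>j<n. Df j (x + 0 \<cdot>\<^sub>v unit_vec n k) * (if j = k then 1 else 0))) (at 0)"
      using that by (intro Df(2)[unfolded partials_def, rule_format]) (auto intro!: derivative_eq_intros)
    also have "(\<Sum>j<n. Df j (x + 0 \<cdot>\<^sub>v unit_vec n k) * (if j = k then 1 else 0)) = Df k (x + 0 \<cdot>\<^sub>v unit_vec n k)"
      using that by (simp add: if_distrib cong: if_cong)
    finally show ?thesis unfolding partial_deriv_def by (rule DERIV_imp_deriv)
  qed
  \<comment> \<open>The sum has dimension \<open>n\<close> whatever the dimension of
    \<open>x\<close>, so it need not equal \<open>x\<close>; both agree in the first
    \<open>n\<close> coordinates, which is all that \<open>Df k\<close> sees.\<close>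
  have eq': "partial_deriv n f k x = Df k x" if "k < n" for k x
    unfolding eq[OF that] by (rule trigpoly_cong[OF Df(1)]) (use that in auto)
  show "trigpoly n (partial_deriv n f k)" if "k < n"
    using Df(1)[of k] eq'[OF that] by (metis ext)
  show "((\<lambda>s. f (c s)) has_real_derivative (\<Sum>k<n. partial_deriv n f k (c t) * c' k)) (at t within S)"
    if "\<And>i. i < n \<Longrightarrow> ((\<lambda>s. c s $ i) has_real_derivative c' i) (at t within S)"
  proof -
    have "(\<Sum>k<n. partial_deriv n f k (c t) * c' k) = (\<Sum>k<n. Df k (c t) * c' k)"
      by (rule sum.cong) (simp_all add: eq')
    thus ?thesis
      using Df(2)[unfolded partials_def, rule_format, OF that] by (simp only:)
  qed
qed

section \<open>Vectors and matrices with trigonometric polynomial entries\<close>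

definition trigpoly_mat :: "nat \<Rightarrow> nat \<Rightarrow> nat \<Rightarrow> (real Matrix.vec \<Rightarrow> real Matrix.mat) \<Rightarrow> bool" where
  "trigpoly_mat n a b A \<longleftrightarrow> (\<forall>\<theta>. A \<theta> \<in> carrier_mat a b) \<and>
     (\<forall>i<a. \<forall>j<b. trigpoly n (\<lambda>\<theta>. A \<theta> $$ (i, j)))"

definition trigpoly_vec :: "nat \<Rightarrow> nat \<Rightarrow> (real Matrix.vec \<Rightarrow> real Matrix.vec) \<Rightarrow> bool" where
  "trigpoly_vec n a v \<longleftrightarrow> (\<forall>\<theta>. v \<theta> \<in> carrier_vec a) \<and> (\<forall>i<a. trigpoly n (\<lambda>\<theta>. v \<theta> $ i))"

lemma trigpoly_mat_const: "A \<in> carrier_mat a b \<Longrightarrow> trigpoly_mat n a b (\<lambda>_. A)"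
  by (simp add: trigpoly_mat_def trigpoly_const)

lemma trigpoly_mat_mult:
  assumes A: "trigpoly_mat n a b A" and B: "trigpoly_mat n b c B"
  shows "trigpoly_mat n a c (\<lambda>\<theta>. A \<theta> * B \<theta>)"
proof -
  have dims: "dim_row (A \<theta>) = a" "dim_col (A \<theta>) = b" "dim_row (B \<theta>) = b" "dim_col (B \<theta>) = c" for \<theta>
    using A B unfolding trigpoly_mat_def by auto
  have eq: "(A \<theta> * B \<theta>) $$ (i, j) = (\<Sum>k = 0..<b. A \<theta> $$ (i, k) * B \<theta> $$ (k, j))" if "i < a" "j < c" for i j \<theta>
    using that by (simp add: dims scalar_prod_def)
  show ?thesis
    unfolding trigpoly_mat_def
  proof (intro conjI allI impI)
    show "A \<theta> * B \<theta> \<in> carrier_mat a c" for \<theta>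
      by (rule carrier_matI) (simp_all only: dims index_mult_mat)
    fix i j assume ij: "i < a" "j < c"
    show "trigpoly n (\<lambda>\<theta>. (A \<theta> * B \<theta>) $$ (i, j))"
      unfolding eq[OF ij] using ij A B unfolding trigpoly_mat_def
      by (intro trigpoly_sum trigpoly_mult) simp_all
  qed
qed

lemma trigpoly_mat_mult_vec:
  assumes A: "trigpoly_mat n a b A" and v: "trigpoly_vec n b v"
  shows "trigpoly_vec n a (\<lambda>\<theta>. A \<theta> *\<^sub>v v \<theta>)"
proof -
  have dims: "dim_row (A \<theta>) = a" "dim_col (A \<theta>) = b" "dim_vec (v \<theta>) = b" for \<theta>
    using A v unfolding trigpoly_mat_def trigpoly_vec_def by auto
  have eq: "(A \<theta> *\<^sub>v v \<theta>) $ i = (\<Sum>k = 0..<b. A \<theta> $$ (i, k) * v \<theta> $ k)" if "i < a" for i \<theta>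
    using that by (simp add: dims scalar_prod_def)
  show ?thesis
    unfolding trigpoly_vec_def
  proof (intro conjI allI impI)
    show "A \<theta> *\<^sub>v v \<theta> \<in> carrier_vec a" for \<theta>
      by (rule carrier_vecI) (simp only: dims dim_mult_mat_vec)
    fix i assume i: "i < a"
    show "trigpoly n (\<lambda>\<theta>. (A \<theta> *\<^sub>v v \<theta>) $ i)"
      unfolding eq[OF i] using i A v unfolding trigpoly_mat_def trigpoly_vec_def
      by (intro trigpoly_sum trigpoly_mult) simp_all
  qed
qed

lemma trigpoly_vec_uminus:
  assumes v: "trigpoly_vec n a v"
  shows "trigpoly_vec n a (\<lambda>\<theta>. - v \<theta>)"
proof -
  have dim: "dim_vec (v \<theta>) = a" for \<theta> using v unfolding trigpoly_vec_def by auto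
  have eq: "(- v \<theta>) $ i = - (v \<theta> $ i)" if "i < a" for i \<theta>
    using that by (simp add: dim)
  show ?thesis
    unfolding trigpoly_vec_def
  proof (intro conjI allI impI)
    show "- v \<theta> \<in> carrier_vec a" for \<theta>
      by (rule carrier_vecI) (simp add: dim)
    fix i assume i: "i < a"
    show "trigpoly n (\<lambda>\<theta>. (- v \<theta>) $ i)"
      unfolding eq[OF i] using i v unfolding trigpoly_vec_def by (intro trigpoly_uminus) simp
  qed
qed

lemma trigpoly_det:
  assumes "trigpoly_mat n a a A"
  shows "trigpoly n (\<lambda>\<theta>. Determinant.det (A \<theta>))"
proof -
  have "Determinant.det (A \<theta>) = (\<Sum>p\<in>{p. p permutes {0..<a}}. signof p * (\<Prod>i = 0..<a. A \<theta> $$ (i, p i)))" for \<theta>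
    using assms by (intro det_def') (auto simp: trigpoly_mat_def)
  thus ?thesis using assms unfolding trigpoly_mat_def
    by (auto intro!: trigpoly_sum trigpoly_mult trigpoly_const trigpoly_prod dest: permutes_in_image)
qed

text \<open>The entries of the adjugate are signed minors, and each minor is the determinant of a
  matrix whose entries occur in the original one.\<close>

lemma trigpoly_adj_mat:
  assumes "trigpoly_mat n a a A"
  shows "trigpoly_mat n a a (\<lambda>\<theta>. adj_mat (A \<theta>))"
proof -
  have A: "A \<theta> \<in> carrier_mat a a" for \<theta> using assms by (simp add: trigpoly_mat_def)
  have d: "trigpoly_mat n (a - 1) (a - 1) (\<lambda>\<theta>. mat_delete (A \<theta>) j i)" if "i < a" "j < a" for i j
    unfolding trigpoly_mat_def
  proof (intro conjI allI impI)
    show "mat_delete (A \<theta>) j i \<in> carrier_mat (a - 1) (a - 1)" for \<theta>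
      using mat_delete_carrier[OF A] .
    fix k l assume kl: "k < a - 1" "l < a - 1"
    define k' where "k' = (if k < j then k else Suc k)"
    define l' where "l' = (if l < i then l else Suc l)"
    have "mat_delete (A \<theta>) j i $$ (k, l) = A \<theta> $$ (k', l')" for \<theta>
    proof -
      have "dim_row (A \<theta>) = a" "dim_col (A \<theta>) = a" using A[of \<theta>] by auto
      thus ?thesis using kl by (simp add: mat_delete_def k'_def l'_def)
    qed
    moreover have "k' < a" "l' < a" using kl by (auto simp: k'_def l'_def)
    ultimately show "trigpoly n (\<lambda>\<theta>. mat_delete (A \<theta>) j i $$ (k, l))"
      using assms by (simp add: trigpoly_mat_def)
  qed
  have "adj_mat (A \<theta>) $$ (i, j) = (- 1) ^ (j + i) * Determinant.det (mat_delete (A \<theta>) j i)"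
    if "i < a" "j < a" for i j \<theta>
  proof -
    have "dim_row (A \<theta>) = a" "dim_col (A \<theta>) = a" using A[of \<theta>] by auto
    thus ?thesis using that by (simp add: adj_mat_def cofactor_def)
  qed
  thus ?thesis using adj_mat(1)[OF A] d
    unfolding trigpoly_mat_def[of n a a "\<lambda>\<theta>. adj_mat (A \<theta>)"]
    by (auto intro!: trigpoly_mult trigpoly_const trigpoly_det)
qed

text \<open>The addition theorem turns the sine of a difference of coordinates into a polynomial in
  their sines and cosines.\<close>

lemma trigpoly_kuramoto_g:
  "trigpoly_vec n n (kuramoto_g n \<gamma>)"
proof -
  have "trigpoly n (\<lambda>\<theta>. sin (angle_diff n \<theta> $ i))" if "i < n" for i
    using that by (auto simp: angle_diff_def sin_diff intro!: trigpoly_diff trigpoly.intros)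
  moreover have "(i + n - 1) mod n < n" if "i < n" for i
    using that by auto
  ultimately have "trigpoly n (\<lambda>\<theta>. - \<gamma> $ i * sin (angle_diff n \<theta> $ i)
      + \<gamma> $ ((i + n - 1) mod n) * sin (angle_diff n \<theta> $ ((i + n - 1) mod n)))" if "i < n" for i
    using that by (intro trigpoly_add trigpoly_mult trigpoly_const) simp_all
  thus ?thesis
    by (simp add: trigpoly_vec_def kuramoto_g_def)
qed

lemma trigpoly_kuramoto_jacobian:
  "trigpoly_mat n n n (kuramoto_jacobian n \<gamma>)"
  using trigpoly_kuramoto_g[of n \<gamma>] trigpoly_partial_deriv_chain(1)
  by (simp add: trigpoly_mat_def trigpoly_vec_def kuramoto_jacobian_def)

lemma trigpoly_mat_reduced:
  assumes "P \<in> carrier_mat m n"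
  shows "trigpoly_mat n m m (\<lambda>\<theta>. P * kuramoto_jacobian n \<gamma> \<theta> * transpose_mat P)"
  using assms
  by (intro trigpoly_mat_mult[OF trigpoly_mat_mult[OF trigpoly_mat_const trigpoly_kuramoto_jacobian]
      trigpoly_mat_const]) simp_all

lemma trigpoly_det_red:
  assumes "P \<in> carrier_mat m n"
  shows "trigpoly n (\<lambda>\<theta>. det_red P (kuramoto_jacobian n \<gamma> \<theta>))"
  unfolding det_red_def by (rule trigpoly_det[OF trigpoly_mat_reduced[OF assms]])

lemma trigpoly_v_field:
  assumes "P \<in> carrier_mat m n"
  shows "trigpoly_vec n n (v_field n P \<gamma>)"
proof -
  have "trigpoly_mat n n m (\<lambda>_. transpose_mat P)"
    using assms by (intro trigpoly_mat_const) simp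
  from trigpoly_vec_uminus[OF trigpoly_mat_mult_vec[OF this trigpoly_mat_mult_vec[OF
      trigpoly_adj_mat[OF trigpoly_mat_reduced[OF assms]]
      trigpoly_mat_mult_vec[OF trigpoly_mat_const[OF assms] trigpoly_kuramoto_g]]]]
  show ?thesis unfolding v_field_def[abs_def] .
qed

subsection \<open>Symmetric real matrices\<close>

lemma scalar_prod_self_pos:
  fixes v :: "real Matrix.vec"
  assumes "v \<in> carrier_vec n" "v \<noteq> 0\<^sub>v n"
  shows "v \<bullet> v > 0"
proof -
  have "v \<bullet> v = (\<Sum>i = 0..<n. (v $ i)^2)"
    using assms(1) by (simp add: scalar_prod_def power2_eq_square)
  moreover obtain i where "i < n" "v $ i \<noteq> 0"
    using assms by (metis carrier_vecD eq_vecI index_zero_vec)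
  ultimately show ?thesis
    by (auto intro!: sum_pos2[of _ i])
qed

text \<open>Over the complex numbers an eigenvalue \<open>l\<close> exists. Symmetry, applied to the
  real and imaginary parts of its eigenvector, forces \<open>l\<close> to be real, and then
  whichever part is nonzero is a real eigenvector.\<close>

lemma symmetric_real_eigenvector:
  fixes A :: "real Matrix.mat"
  assumes A: "A \<in> carrier_mat n n" and sym: "transpose_mat A = A" and n: "n > 0"
  obtains e v where "v \<in> carrier_vec n" "v \<noteq> 0\<^sub>v n" "A *\<^sub>v v = e \<cdot>\<^sub>v v"
proof -
  let ?C = "map_mat complex_of_real A"
  have C: "?C \<in> carrier_mat n n" using A by simp
  obtain l where "eigenvalue ?C l"
    using spectrum_non_empty[OF C n] by (auto simp: spectrum_def)
  then obtain z where "eigenvector ?C z l" unfolding eigenvalue_def by blast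
  hence z: "z \<in> carrier_vec n" "z \<noteq> 0\<^sub>v n" "?C *\<^sub>v z = l \<cdot>\<^sub>v z"
    using C unfolding eigenvector_def by auto
  define x where "x = map_vec Re z"
  define y where "y = map_vec Im z"
  have xy: "x \<in> carrier_vec n" "y \<in> carrier_vec n" using z(1) by (auto simp: x_def y_def)
  have dim: "dim_vec z = n" "dim_vec x = n" "dim_vec y = n" "dim_row A = n" "dim_col A = n"
    using z(1) xy A by auto
  have eq: "(\<Sum>k = 0..<n. complex_of_real (A $$ (i, k)) * z $ k) = l * z $ i" if "i < n" for i
    using arg_cong[OF z(3), of "\<lambda>v. v $ i"] that by (simp add: scalar_prod_def dim)
  have Ax: "A *\<^sub>v x = Re l \<cdot>\<^sub>v x - Im l \<cdot>\<^sub>v y"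
  proof (rule eq_vecI)
    fix i assume "i < dim_vec (Re l \<cdot>\<^sub>v x - Im l \<cdot>\<^sub>v y)"
    hence i: "i < n" by (simp add: dim)
    have "(A *\<^sub>v x) $ i = (\<Sum>k = 0..<n. A $$ (i, k) * Re (z $ k))"
      using i by (simp add: scalar_prod_def dim x_def)
    also have "\<dots> = Re (\<Sum>k = 0..<n. complex_of_real (A $$ (i, k)) * z $ k)"
      by simp
    also have "\<dots> = (Re l \<cdot>\<^sub>v x - Im l \<cdot>\<^sub>v y) $ i"
      unfolding eq[OF i] using i by (simp add: dim x_def y_def)
    finally show "(A *\<^sub>v x) $ i = (Re l \<cdot>\<^sub>v x - Im l \<cdot>\<^sub>v y) $ i" .
  qed (simp add: dim)
  have Ay: "A *\<^sub>v y = Im l \<cdot>\<^sub>v x + Re l \<cdot>\<^sub>v y"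
  proof (rule eq_vecI)
    fix i assume "i < dim_vec (Im l \<cdot>\<^sub>v x + Re l \<cdot>\<^sub>v y)"
    hence i: "i < n" by (simp add: dim)
    have "(A *\<^sub>v y) $ i = (\<Sum>k = 0..<n. A $$ (i, k) * Im (z $ k))"
      using i by (simp add: scalar_prod_def dim y_def)
    also have "\<dots> = Im (\<Sum>k = 0..<n. complex_of_real (A $$ (i, k)) * z $ k)"
      by simp
    also have "\<dots> = (Im l \<cdot>\<^sub>v x + Re l \<cdot>\<^sub>v y) $ i"
      unfolding eq[OF i] using i by (simp add: dim x_def y_def)
    finally show "(A *\<^sub>v y) $ i = (Im l \<cdot>\<^sub>v x + Re l \<cdot>\<^sub>v y) $ i" .
  qed (simp add: dim)
  \<comment> \<open>Expanding by \<open>Ax\<close> and \<open>Ay\<close> cancels the mixed terms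
    \<open>Re l * (x \<bullet> y)\<close> and leaves
    \<open>- Im l * (y \<bullet> y) = Im l * (x \<bullet> x)\<close>.\<close>
  have "y \<bullet> (A *\<^sub>v x) = (A *\<^sub>v y) \<bullet> x"
    using transpose_vec_mult_scalar[OF A xy] sym by simp
  hence 1: "Im l * (x \<bullet> x + y \<bullet> y) = 0"
    unfolding Ax Ay using xy comm_scalar_prod[OF xy]
    by (simp add: scalar_prod_minus_distrib[of _ n] add_scalar_prod_distrib[of _ n] algebra_simps)
  have nz: "x \<noteq> 0\<^sub>v n \<or> y \<noteq> 0\<^sub>v n"
  proof (rule ccontr)
    assume "\<not> ?thesis"
    hence "x $ i = 0" "y $ i = 0" if "i < n" for i using that by auto
    hence "z $ i = 0" if "i < n" for i using that by (simp add: x_def y_def dim complex_eq_iff)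
    hence "z = 0\<^sub>v n" by (intro eq_vecI) (auto simp: dim)
    with z(2) show False ..
  qed
  have "x \<bullet> x \<ge> 0" "y \<bullet> y \<ge> 0" by (simp_all add: scalar_prod_def sum_nonneg)
  moreover have "x \<bullet> x > 0 \<or> y \<bullet> y > 0"
    using nz scalar_prod_self_pos xy by blast
  ultimately have "Im l = 0" using 1 by auto
  hence "A *\<^sub>v x = Re l \<cdot>\<^sub>v x" "A *\<^sub>v y = Re l \<cdot>\<^sub>v y"
    using Ax Ay by (auto intro!: eq_vecI simp: dim)
  thus thesis using nz xy that by blast
qed

text \<open>The reflection in the hyperplane orthogonal to v - e_0 swaps the unit vectors e_0 and v.
  It serves to complete v to an orthonormal basis.\<close>

lemma householder_reflection:
  fixes v :: "real Matrix.vec"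
  assumes v: "v \<in> carrier_vec n" "v \<bullet> v = 1" and n: "n > 0"
  obtains H where "H \<in> carrier_mat n n" "transpose_mat H = H" "H * H = 1\<^sub>m n" "Matrix.col H 0 = v"
proof -
  define w where "w i = v $ i - (if i = 0 then 1 else 0)" for i
  define q where "q = (\<Sum>k = 0..<n. w k * w k)"
  \<comment> \<open>If v = e_0, then \<open>q = 0\<close> and division by zero gives
    \<open>c = 0\<close>, so \<open>H\<close> is the identity, as it should be.\<close>
  define c where "c = 2 / q"
  define H where "H = Matrix.mat n n (\<lambda>(i, j). (if i = j then 1 else 0) - c * (w i * w j))"
  have vv: "(\<Sum>k = 0..<n. v $ k * v $ k) = 1"
    using v by (simp add: scalar_prod_def)
  have "q = (\<Sum>k = 0..<n. v $ k * v $ k + (if k = 0 then 1 - 2 * v $ k else 0))"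
    unfolding q_def w_def by (rule sum.cong) (auto simp: algebra_simps)
  also have "\<dots> = 2 - 2 * v $ 0"
    using n by (simp add: sum.distrib vv)
  finally have q: "q = - 2 * w 0" by (simp add: w_def)
  have w0: "w k = 0" if "q = 0" "k < n" for k
  proof -
    have "w k * w k = 0"
      using that sum_nonneg_eq_0_iff[of "{0..<n}" "\<lambda>k. w k * w k"] unfolding q_def by auto
    thus ?thesis by simp
  qed
  have c: "c * (w i * w 0) = - w i" if "i < n" for i
    using w0[OF _ that] q by (cases "q = 0") (auto simp: c_def field_simps)
  have cq: "c * c * q = 2 * c" by (simp add: c_def)
  have "H * H = 1\<^sub>m n"
  proof (rule eq_matI)
    fix i j assume "i < dim_row (1\<^sub>m n :: real Matrix.mat)" "j < dim_col (1\<^sub>m n :: real Matrix.mat)"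
    hence ij: "i < n" "j < n" by auto
    have "(H * H) $$ (i, j) = (\<Sum>k = 0..<n. H $$ (i, k) * H $$ (k, j))"
      using ij by (simp add: scalar_prod_def H_def)
    also have "\<dots> = (\<Sum>k = 0..<n. (if k = i then (if i = j then 1 else 0) - c * (w i * w j) else 0)
        - (if k = j then c * (w i * w j) else 0) + c * c * (w i * w j) * (w k * w k))"
      using ij by (intro sum.cong) (auto simp: H_def algebra_simps)
    also have "\<dots> = (if i = j then 1 else 0) - 2 * c * (w i * w j) + (c * c * q) * (w i * w j)"
      using ij by (simp add: sum.distrib sum_subtractf sum_distrib_left[symmetric] q_def[symmetric])
    also have "\<dots> = 1\<^sub>m n $$ (i, j)" using ij by (simp add: cq)
    finally show "(H * H) $$ (i, j) = 1\<^sub>m n $$ (i, j)" .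
  qed (auto simp: H_def)
  moreover have "Matrix.col H 0 = v"
  proof (rule eq_vecI)
    fix i assume "i < dim_vec v"
    hence i: "i < n" using v by simp
    have "Matrix.col H 0 $ i = (if i = 0 then 1 else 0) - c * (w i * w 0)"
      using i n by (simp add: H_def)
    also have "\<dots> = v $ i" unfolding c[OF i] by (simp add: w_def)
    finally show "Matrix.col H 0 $ i = v $ i" .
  qed (use v in \<open>simp add: H_def\<close>)
  moreover have "transpose_mat H = H" by (rule eq_matI) (auto simp: H_def)
  moreover have "H \<in> carrier_mat n n" by (simp add: H_def)
  ultimately show thesis using that by blast
qed

text \<open>Deflation: conjugating with a reflection that has a unit eigenvector as its first column
  leaves, by symmetry, a block diagonal matrix, whose lower block the induction hypothesis
  diagonalises.\<close>

theorem real_symmetric_spectral: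
  fixes A :: "real Matrix.mat"
  assumes "A \<in> carrier_mat n n" "transpose_mat A = A"
  shows "\<exists>U d. U \<in> carrier_mat n n \<and> transpose_mat U * U = 1\<^sub>m n \<and>
    transpose_mat U * A * U = mat_diag n d"
  using assms
proof (induction n arbitrary: A)
  case 0
  thus ?case by (intro exI[of _ "1\<^sub>m 0"] exI[of _ "\<lambda>_. 0"]) (auto simp: mat_diag_def)
next
  case (Suc m)
  note A = Suc.prems(1) and sym = Suc.prems(2)
  let ?n = "Suc m"
  obtain e v0 where v0: "v0 \<in> carrier_vec ?n" "v0 \<noteq> 0\<^sub>v ?n" "A *\<^sub>v v0 = e \<cdot>\<^sub>v v0"
    by (rule symmetric_real_eigenvector[OF A sym]) simp_all
  define v where "v = (1 / sqrt (v0 \<bullet> v0)) \<cdot>\<^sub>v v0"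
  have pos: "v0 \<bullet> v0 > 0" by (rule scalar_prod_self_pos[OF v0(1,2)])
  have v: "v \<in> carrier_vec ?n" "v \<bullet> v = 1"
    using v0(1) pos by (auto simp: v_def)
  have Av: "A *\<^sub>v v = e \<cdot>\<^sub>v v"
    unfolding v_def mult_mat_vec[OF A v0(1)] v0(3) by (simp add: smult_smult_assoc mult.commute)
  obtain H where H: "H \<in> carrier_mat ?n ?n" "transpose_mat H = H" "H * H = 1\<^sub>m ?n" "Matrix.col H 0 = v"
    using householder_reflection[OF v] by blast
  define B where "B = H * A * H"
  have B: "B \<in> carrier_mat ?n ?n" using H A by (simp add: B_def)
  have symB: "transpose_mat B = B"
    unfolding B_def using H(1,2) A sym
    by (simp add: transpose_mult[of _ ?n ?n _ ?n] assoc_mult_mat[of _ ?n ?n _ ?n _ ?n])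
  have "Matrix.col B 0 = (H * A) *\<^sub>v Matrix.col H 0"
    unfolding B_def by (rule col_mult2[of _ ?n ?n _ ?n]) (use H A in auto)
  also have "\<dots> = H *\<^sub>v (e \<cdot>\<^sub>v v)"
    unfolding H(4) Av[symmetric] by (rule assoc_mult_mat_vec[OF H(1) A v(1)])
  also have "\<dots> = e \<cdot>\<^sub>v (H *\<^sub>v Matrix.col H 0)"
    unfolding H(4) by (rule mult_mat_vec[OF H(1) v(1)])
  also have "H *\<^sub>v Matrix.col H 0 = Matrix.col (H * H) 0"
    by (rule col_mult2[symmetric, OF H(1) H(1)]) simp
  also have "\<dots> = unit_vec ?n 0" unfolding H(3) by simp
  finally have colB: "Matrix.col B 0 = e \<cdot>\<^sub>v unit_vec ?n 0" .
  have B0: "B $$ (i, 0) = (if i = 0 then e else 0)" if "i < ?n" for i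
    using arg_cong[OF colB, of "\<lambda>u. u $ i"] that B by auto
  have Bsym: "B $$ (i, j) = B $$ (j, i)" if "i < ?n" "j < ?n" for i j
    using arg_cong[OF symB, of "\<lambda>M. M $$ (i, j)"] that B by auto
  define B' where "B' = Matrix.mat m m (\<lambda>(i, j). B $$ (Suc i, Suc j))"
  have B': "B' \<in> carrier_mat m m" "transpose_mat B' = B'"
    using Bsym by (auto simp: B'_def intro!: eq_matI)
  define E where "E = Matrix.mat 1 1 (\<lambda>_. e)"
  have E: "E \<in> carrier_mat 1 1" by (simp add: E_def)
  have blockB: "B = four_block_mat E (0\<^sub>m 1 m) (0\<^sub>m m 1) B'"
  proof (rule eq_matI)
    fix i j assume "i < dim_row (four_block_mat E (0\<^sub>m 1 m) (0\<^sub>m m 1) B')"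
      "j < dim_col (four_block_mat E (0\<^sub>m 1 m) (0\<^sub>m m 1) B')"
    hence ij: "i < ?n" "j < ?n" by (auto simp: E_def B'_def)
    show "B $$ (i, j) = four_block_mat E (0\<^sub>m 1 m) (0\<^sub>m m 1) B' $$ (i, j)"
      using ij B0[of i] B0[of j] Bsym[OF ij]
      by (cases i; cases j) (auto simp: E_def B'_def)
  qed (use B in \<open>auto simp: E_def B'_def\<close>)
  obtain U' d' where U': "U' \<in> carrier_mat m m" "transpose_mat U' * U' = 1\<^sub>m m"
    "transpose_mat U' * B' * U' = mat_diag m d'"
    using Suc.IH[OF B'] by blast
  define V where "V = four_block_mat (1\<^sub>m 1) (0\<^sub>m 1 m) (0\<^sub>m m 1) U'"
  have V: "V \<in> carrier_mat ?n ?n"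
    using four_block_carrier_mat[OF one_carrier_mat U'(1), of 1] by (simp add: V_def)
  have Vt: "transpose_mat V = four_block_mat (1\<^sub>m 1) (0\<^sub>m 1 m) (0\<^sub>m m 1) (transpose_mat U')"
    unfolding V_def using U'(1) by (subst transpose_four_block_mat[of _ 1 1 _ m _ m]) auto
  have VV: "transpose_mat V * V = 1\<^sub>m ?n"
  proof -
    have "transpose_mat V * V = four_block_mat (1\<^sub>m 1) (0\<^sub>m 1 m) (0\<^sub>m m 1) (1\<^sub>m m)"
      unfolding Vt unfolding V_def using U'
      by (subst mult_four_block_mat[of _ 1 1 _ m _ m _ _ 1 _ m]) auto
    also have "\<dots> = 1\<^sub>m ?n" by (rule eq_matI) auto
    finally show ?thesis .
  qed
  have VBV: "transpose_mat V * B * V = mat_diag ?n (\<lambda>i. case i of 0 \<Rightarrow> e | Suc j \<Rightarrow> d' j)"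
  proof -
    have "transpose_mat V * B = four_block_mat E (0\<^sub>m 1 m) (0\<^sub>m m 1) (transpose_mat U' * B')"
      unfolding Vt blockB using U' E B'
      by (subst mult_four_block_mat[of _ 1 1 _ m _ m _ _ 1 _ m]) auto
    also have "\<dots> * V = four_block_mat E (0\<^sub>m 1 m) (0\<^sub>m m 1) (transpose_mat U' * B' * U')"
      unfolding V_def using U' E B'
      by (subst mult_four_block_mat[of _ 1 1 _ m _ m _ _ 1 _ m]) auto
    also have "\<dots> = mat_diag ?n (\<lambda>i. case i of 0 \<Rightarrow> e | Suc j \<Rightarrow> d' j)"
      unfolding U'(3) by (rule eq_matI) (auto simp: mat_diag_def E_def split: nat.splits)
    finally show ?thesis .
  qed
  have HV: "transpose_mat (H * V) = transpose_mat V * H"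
    using transpose_mult[OF H(1) V] H(2) by simp
  note assoc = assoc_mult_mat[of _ ?n ?n _ ?n _ ?n]
  have Vt_c: "transpose_mat V \<in> carrier_mat ?n ?n" using V by simp
  have "transpose_mat (H * V) * (H * V) = transpose_mat V * ((H * H) * V)"
    unfolding HV using H(1) V Vt_c by (simp add: assoc)
  also have "\<dots> = 1\<^sub>m ?n" unfolding H(3) using V VV by simp
  finally have 1: "transpose_mat (H * V) * (H * V) = 1\<^sub>m ?n" .
  have "transpose_mat (H * V) * A * (H * V) = transpose_mat V * B * V"
    unfolding HV B_def using H(1) V Vt_c A by (simp add: assoc)
  with VBV have 2: "transpose_mat (H * V) * A * (H * V) = mat_diag ?n (\<lambda>i. case i of 0 \<Rightarrow> e | Suc j \<Rightarrow> d' j)"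
    by simp
  show ?case using 1 2 H(1) V
    by (intro exI[of _ "H * V"] exI[of _ "\<lambda>i. case i of 0 \<Rightarrow> e | Suc j \<Rightarrow> d' j"]) simp
qed

section \<open>Inertia of quadratic forms\<close>

lemma common_zero_of_few_functionals:
  fixes fs :: "real Matrix.vec list"
  assumes len: "length fs < n" and fs: "set fs \<subseteq> carrier_vec n"
  obtains x where "x \<in> carrier_vec n" "x \<noteq> 0\<^sub>v n" "\<And>f. f \<in> set fs \<Longrightarrow> f \<bullet> x = 0"
proof -
  define k where "k = length fs"
  define c where "c i = (if i < k then fs ! i else 0\<^sub>v n)" for i
  have c: "c i \<in> carrier_vec n" for i using fs by (auto simp: c_def k_def)
  \<comment> \<open>Fewer than \<open>n\<close> functionals leave room for a zero row at index
    \<open>k\<close>. The square matrix is therefore singular, and a kernel vector is a common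
    zero.\<close>
  define A where "A = mat\<^sub>r n n (\<lambda>i. if i = k then 0\<^sub>v n else c i)"
  have A: "A \<in> carrier_mat n n" by (simp add: A_def)
  have "Determinant.det A = 0"
    unfolding A_def by (rule det_row_0) (use len c in \<open>auto simp: k_def\<close>)
  then obtain x where x: "x \<in> carrier_vec n" "x \<noteq> 0\<^sub>v n" "A *\<^sub>v x = 0\<^sub>v n"
    using det_0_iff_vec_prod_zero_field[OF A] by blast
  have "f \<bullet> x = 0" if "f \<in> set fs" for f
  proof -
    obtain i where i: "i < k" "f = fs ! i" using \<open>f \<in> set fs\<close> by (metis in_set_conv_nth k_def)
    hence "i < n" using len by (simp add: k_def)
    have "Matrix.row A i = f"
      unfolding A_def using \<open>i < n\<close> c[of i] i by (subst row_mat_of_row_fun) (auto simp: c_def)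
    moreover have "(A *\<^sub>v x) $ i = 0" using x(3) \<open>i < n\<close> by simp
    ultimately show ?thesis using \<open>i < n\<close> A by simp
  qed
  thus thesis using x that by blast
qed

text \<open>A dimension count as in Sylvester's law of inertia. If the bound failed, some nonzero x
  would be annihilated by \<open>q\<close>, by the \<open>r i\<close> of nonpositive weight and by
  the \<open>u l\<close> of positive weight. One side of \<open>form\<close> is then at most 0 and
  the other at least 0, so every \<open>r i\<close> vanishes at x, against \<open>zero\<close>. The
  summand 1 pays for \<open>q\<close>, which cuts down the common kernel of the
  \<open>r i\<close>.\<close>

lemma inertia_bound:
  fixes u r :: "nat \<Rightarrow> real Matrix.vec" and d w :: "nat \<Rightarrow> real"
  assumes u: "\<And>l. l < m \<Longrightarrow> u l \<in> carrier_vec n" and r: "\<And>i. i < k \<Longrightarrow> r i \<in> carrier_vec n"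
    and q: "q \<in> carrier_vec n"
    and form: "\<And>x. x \<in> carrier_vec n \<Longrightarrow> (\<Sum>l<m. d l * (u l \<bullet> x)^2) = (\<Sum>i<k. w i * (r i \<bullet> x)^2)"
    and zero: "\<And>x. x \<in> carrier_vec n \<Longrightarrow> (\<And>i. i < k \<Longrightarrow> r i \<bullet> x = 0) \<Longrightarrow> q \<bullet> x = 0 \<Longrightarrow> x = 0\<^sub>v n"
  shows "n \<le> card {i. i < k \<and> w i \<le> 0} + card {l. l < m \<and> d l > 0} + 1"
proof (rule ccontr)
  assume less: "\<not> ?thesis"
  define I where "I = sorted_list_of_set {i. i < k \<and> w i \<le> 0}"
  define K where "K = sorted_list_of_set {l. l < m \<and> d l > 0}"
  have I: "set I = {i. i < k \<and> w i \<le> 0}" "length I = card {i. i < k \<and> w i \<le> 0}"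
    and K: "set K = {l. l < m \<and> d l > 0}" "length K = card {l. l < m \<and> d l > 0}"
    by (auto simp: I_def K_def)
  obtain x where x: "x \<in> carrier_vec n" "x \<noteq> 0\<^sub>v n"
    "\<And>f. f \<in> set (q # map r I @ map u K) \<Longrightarrow> f \<bullet> x = 0"
  proof (rule common_zero_of_few_functionals[of "q # map r I @ map u K" n])
    show "length (q # map r I @ map u K) < n" using less I(2) K(2) by simp
    show "set (q # map r I @ map u K) \<subseteq> carrier_vec n" using u r q I(1) K(1) by auto
  qed blast
  have qx: "q \<bullet> x = 0" using x(3) by simp
  have rx: "r i \<bullet> x = 0" if "i < k" "w i \<le> 0" for i using x(3)[of "r i"] that I(1) by auto
  have ux: "u l \<bullet> x = 0" if "l < m" "d l > 0" for l using x(3)[of "u l"] that K(1) by auto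
  have "(\<Sum>l<m. d l * (u l \<bullet> x)^2) \<le> 0"
  proof (rule sum_nonpos)
    fix l assume "l \<in> {..<m}"
    thus "d l * (u l \<bullet> x)^2 \<le> 0"
      using ux[of l] by (cases "d l > 0") (auto simp: mult_nonpos_nonneg)
  qed
  hence le: "(\<Sum>i<k. w i * (r i \<bullet> x)^2) \<le> 0" unfolding form[OF x(1)] .
  have nn: "w i * (r i \<bullet> x)^2 \<ge> 0" if "i < k" for i
    using rx[OF that] by (cases "w i \<le> 0") auto
  have "(\<Sum>i<k. w i * (r i \<bullet> x)^2) = 0" using le nn by (intro antisym sum_nonneg) auto
  hence w0: "w i * (r i \<bullet> x)^2 = 0" if "i < k" for i
    using sum_nonneg_eq_0_iff[of "{..<k}" "\<lambda>i. w i * (r i \<bullet> x)^2"] nn that by auto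
  have "r i \<bullet> x = 0" if "i < k" for i
    using rx[OF that] w0[OF that] by (cases "w i \<le> 0") auto
  hence "x = 0\<^sub>v n" using zero[OF x(1)] qx by blast
  with x(2) show False ..
qed

section \<open>The reduced determinant and the spectrum\<close>

lemma proots_linear_factors:
  "proots (\<Prod>a\<leftarrow>xs. [:- a, 1:]) = mset (xs :: real list)"
proof (induction xs)
  case (Cons a xs)
  have "(\<Prod>a\<leftarrow>xs. [:- a, 1:]) \<noteq> (0 :: real poly)" by auto
  hence "proots ([:- a, 1:] * (\<Prod>a\<leftarrow>xs. [:- a, 1:])) = {#a#} + proots (\<Prod>a\<leftarrow>xs. [:- a, 1:])"
    by (subst proots_mult) simp_all
  thus ?case unfolding list.map prod_list.Cons Cons by simp
qed simp

text \<open>By the spanning clause a vector orthogonal to \<open>ones\<close> has the form P^T c,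
  and P P^T = 1 recovers c from it; hence P^T P fixes such vectors.\<close>

lemma onb_ones_perpD:
  assumes "onb_ones_perp n P"
  shows "P \<in> carrier_mat (n - 1) n" "P * transpose_mat P = 1\<^sub>m (n - 1)" "P *\<^sub>v ones n = 0\<^sub>v (n - 1)"
    "x \<in> carrier_vec n \<Longrightarrow> x \<bullet> ones n = 0 \<Longrightarrow> transpose_mat P *\<^sub>v (P *\<^sub>v x) = x"
proof -
  show P: "P \<in> carrier_mat (n - 1) n" using assms by (simp add: onb_ones_perp_def)
  have ones: "ones n \<in> carrier_vec n" by (simp add: ones_def)
  show PP: "P * transpose_mat P = 1\<^sub>m (n - 1)"
    by (rule eq_matI) (use assms P in \<open>auto simp: onb_ones_perp_def\<close>)
  have span: "{transpose_mat P *\<^sub>v c |c. c \<in> carrier_vec (n - 1)} = {x \<in> carrier_vec n. x \<bullet> ones n = 0}"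
    using assms by (simp add: onb_ones_perp_def)
  show "P *\<^sub>v ones n = 0\<^sub>v (n - 1)"
  proof (rule eq_vecI)
    fix i assume "i < dim_vec (0\<^sub>v (n - 1) :: real Matrix.vec)"
    hence i: "i < n - 1" by simp
    have "transpose_mat P *\<^sub>v unit_vec (n - 1) i \<in> {transpose_mat P *\<^sub>v c |c. c \<in> carrier_vec (n - 1)}"
      by (intro CollectI exI conjI) (rule refl, simp)
    hence "(transpose_mat P *\<^sub>v unit_vec (n - 1) i) \<bullet> ones n = 0"
      unfolding span by simp
    hence "unit_vec (n - 1) i \<bullet> (P *\<^sub>v ones n) = 0"
      using transpose_vec_mult_scalar[OF P ones, of "unit_vec (n - 1) i"] by simp
    thus "(P *\<^sub>v ones n) $ i = 0\<^sub>v (n - 1) $ i"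
      using i P ones by (simp add: mult_mat_vec_carrier[OF P ones])
  qed (use P in simp)
  assume "x \<in> carrier_vec n" "x \<bullet> ones n = 0"
  hence "x \<in> {transpose_mat P *\<^sub>v c |c. c \<in> carrier_vec (n - 1)}" unfolding span by simp
  then obtain c where c: "c \<in> carrier_vec (n - 1)" "x = transpose_mat P *\<^sub>v c"
    by (elim CollectE exE conjE)
  have Pt: "transpose_mat P \<in> carrier_mat n (n - 1)" using P by simp
  have "P *\<^sub>v x = (P * transpose_mat P) *\<^sub>v c"
    unfolding c(2) by (rule assoc_mult_mat_vec[OF P Pt c(1), symmetric])
  also have "\<dots> = c" unfolding PP using c(1) by simp
  finally show "transpose_mat P *\<^sub>v (P *\<^sub>v x) = x" using c(2) by simp
qed

lemma diag_mat_mat_diag: "diag_mat (mat_diag n d) = map d [0..<n]"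
  by (auto simp: diag_mat_def mat_diag_def)

lemma upper_triangular_mat_diag: "upper_triangular (mat_diag n d)"
  by (rule upper_triangularI) (simp add: mat_diag_def)

lemma det_mat_diag: "Determinant.det (mat_diag n d) = (\<Prod>l<n. d l :: real)"
  unfolding det_upper_triangular[OF upper_triangular_mat_diag mat_diag_dim] diag_mat_mat_diag
  by (simp add: prod.list_conv_set_nth atLeast0LessThan)

lemma char_poly_mat_diag: "char_poly (mat_diag n d) = (\<Prod>a\<leftarrow>map d [0..<n]. [:- a, 1 :: real:])"
  unfolding char_poly_upper_triangular[OF mat_diag_dim upper_triangular_mat_diag] diag_mat_mat_diag ..

text \<open>P^T carries an orthonormal eigenbasis of P M P^T to eigenvectors of M in the complement
  of \<open>ones\<close>, and the normalised \<open>ones\<close> completes them to an orthonormal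
  basis. Its eigenvalue 0 is the additional element of the spectrum and drops out of the quadratic
  form, which leaves \<open>n - 1\<close> squares.\<close>

lemma det_red_spectral:
  assumes onb: "onb_ones_perp n P" and n: "n \<ge> 1"
    and M: "M \<in> carrier_mat n n" and sym: "transpose_mat M = M" and M1: "M *\<^sub>v ones n = 0\<^sub>v n"
  obtains d u where "\<And>l. l < n - 1 \<Longrightarrow> u l \<in> carrier_vec n"
    "real_eigenvalues M = add_mset 0 (mset (map d [0..<n - 1]))"
    "(\<Prod>l<n - 1. d l) = det_red P M"
    "\<And>x. x \<in> carrier_vec n \<Longrightarrow> x \<bullet> (M *\<^sub>v x) = (\<Sum>l<n - 1. d l * (u l \<bullet> x)^2)"
proof -
  let ?m = "n - 1"
  note P = onb_ones_perpD(1)[OF onb] and PPt = onb_ones_perpD(2)[OF onb] and P1 = onb_ones_perpD(3)[OF onb]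
  have Pt: "transpose_mat P \<in> carrier_mat n ?m" using P by simp
  have ones: "ones n \<in> carrier_vec n" by (simp add: ones_def)
  define A where "A = P * M * transpose_mat P"
  have A: "A \<in> carrier_mat ?m ?m" unfolding A_def using P M by auto
  have symA: "transpose_mat A = A"
  proof -
    have "transpose_mat A = P * (transpose_mat M * transpose_mat P)"
      unfolding A_def transpose_mult[OF mult_carrier_mat[OF P M] Pt] transpose_mult[OF P M] by simp
    thus ?thesis unfolding A_def sym using assoc_mult_mat[OF P M Pt] by simp
  qed
  obtain U d where U: "U \<in> carrier_mat ?m ?m" "transpose_mat U * U = 1\<^sub>m ?m"
    and UAU: "transpose_mat U * A * U = mat_diag ?m d"
    using real_symmetric_spectral[OF A symA] by blast
  have Ut: "transpose_mat U \<in> carrier_mat ?m ?m" using U by simp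
  have UUt: "U * transpose_mat U = 1\<^sub>m ?m"
    by (rule mat_mult_left_right_inverse[OF Ut U(1,2)])
  have detA: "(\<Prod>l<?m. d l) = det_red P M"
  proof -
    have "(\<Prod>l<?m. d l) = Determinant.det (transpose_mat U) * Determinant.det A * Determinant.det U"
      unfolding det_mat_diag[symmetric] UAU[symmetric] using Ut A U(1) by (simp add: det_mult[of _ ?m])
    also have "\<dots> = Determinant.det (transpose_mat U * U) * Determinant.det A"
      using Ut U(1) by (simp add: det_mult[of _ ?m])
    also have "\<dots> = Determinant.det A" unfolding U(2) by simp
    finally show ?thesis by (simp add: det_red_def A_def)
  qed
  define Q0 where "Q0 = transpose_mat U * P"
  have Q0: "Q0 \<in> carrier_mat ?m n" unfolding Q0_def using Ut P by simp
  have Q0t: "transpose_mat Q0 = transpose_mat P * U"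
    unfolding Q0_def by (subst transpose_mult[OF Ut P]) simp
  have Q0tc: "transpose_mat Q0 \<in> carrier_mat n ?m" using Q0 by simp
  have Q0Q0t: "Q0 * transpose_mat Q0 = 1\<^sub>m ?m"
  proof -
    have "Q0 * transpose_mat Q0 = transpose_mat U * (P * (transpose_mat P * U))"
      unfolding Q0t unfolding Q0_def by (rule assoc_mult_mat[OF Ut P mult_carrier_mat[OF Pt U(1)]])
    also have "P * (transpose_mat P * U) = U"
      using assoc_mult_mat[OF P Pt U(1)] U(1) by (simp add: PPt)
    finally show ?thesis using U(2) by simp
  qed
  have Q0MQ0t: "Q0 * (M * transpose_mat Q0) = mat_diag ?m d"
  proof -
    have "Q0 * (M * transpose_mat Q0) = transpose_mat U * (P * (M * (transpose_mat P * U)))"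
      unfolding Q0t unfolding Q0_def by (rule assoc_mult_mat[OF Ut P mult_carrier_mat[OF M mult_carrier_mat[OF Pt U(1)]]])
    also have "P * (M * (transpose_mat P * U)) = A * U"
      unfolding A_def assoc_mult_mat[OF mult_carrier_mat[OF P M] Pt U(1)]
      by (rule assoc_mult_mat[OF P M mult_carrier_mat[OF Pt U(1)], symmetric])
    also have "transpose_mat U * (A * U) = mat_diag ?m d"
      using assoc_mult_mat[OF Ut A U(1)] UAU by simp
    finally show ?thesis .
  qed
  have Q01: "Q0 *\<^sub>v ones n = 0\<^sub>v ?m"
  proof -
    have "transpose_mat U *\<^sub>v 0\<^sub>v ?m = 0\<^sub>v ?m"
      by (rule eq_vecI) (use U(1) in \<open>auto simp: scalar_prod_def\<close>)
    thus ?thesis unfolding Q0_def assoc_mult_mat_vec[OF Ut P ones] P1 .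
  qed
  define q where "q l = (if l < ?m then Matrix.row Q0 l else (1 / sqrt n) \<cdot>\<^sub>v ones n)" for l
  have q: "q l \<in> carrier_vec n" for l using Q0 ones by (auto simp: q_def)
  have onesones: "ones n \<bullet> ones n = real n" by (simp add: ones_def scalar_prod_def)
  have qones: "q l \<bullet> ones n = 0" if "l < ?m" for l
    using arg_cong[OF Q01, of "\<lambda>v. v $ l"] that Q0 by (simp add: q_def)
  have qq: "q l \<bullet> q k = (if l = k then 1 else 0)" if lk: "l < n" "k < n" for l k
  proof -
    consider "l < ?m" "k < ?m" | "l < ?m" "k = ?m" | "l = ?m" "k < ?m" | "l = ?m" "k = ?m"
      using lk by linarith
    thus ?thesis
    proof cases
      case 1
      have "(Q0 * transpose_mat Q0) $$ (l, k) = q l \<bullet> q k" using 1 Q0 by (simp add: q_def)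
      thus ?thesis using 1 by (simp add: Q0Q0t)
    next
      case 2
      have "q k = (1 / sqrt n) \<cdot>\<^sub>v ones n" using 2 by (simp add: q_def)
      thus ?thesis using 2 qones[of l] scalar_prod_smult_distrib[OF q[of l] ones] by simp
    next
      case 3
      have "q l = (1 / sqrt n) \<cdot>\<^sub>v ones n" using 3 by (simp add: q_def)
      thus ?thesis using 3 qones[of k] smult_scalar_prod_distrib[OF ones q[of k]]
          comm_scalar_prod[OF q[of k] ones] by simp
    next
      case 4
      have "q l = (1 / sqrt n) \<cdot>\<^sub>v ones n" "q k = (1 / sqrt n) \<cdot>\<^sub>v ones n" using 4 by (simp_all add: q_def)
      thus ?thesis using 4 n onesones
        by (simp add: smult_scalar_prod_distrib[OF ones smult_carrier_vec[THEN iffD2, OF ones]]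
            scalar_prod_smult_distrib[OF ones ones])
    qed
  qed
  have Mq: "M *\<^sub>v q k = 0\<^sub>v n" if "\<not> k < ?m" for k
    using that mult_mat_vec[OF M ones] M1 by (auto simp: q_def)
  define d' where "d' l = (if l < ?m then d l else 0)" for l
  have qMq: "q l \<bullet> (M *\<^sub>v q k) = (if l = k then d' k else 0)" if lk: "l < n" "k < n" for l k
  proof -
    consider "l < ?m" "k < ?m" | "\<not> k < ?m" | "\<not> l < ?m" "k < ?m" by blast
    thus ?thesis
    proof cases
      case 1
      have "(Q0 * (M * transpose_mat Q0)) $$ (l, k) = Matrix.row Q0 l \<bullet> Matrix.col (M * transpose_mat Q0) k"
        using 1 Q0 M by simp
      also have "Matrix.col (M * transpose_mat Q0) k = M *\<^sub>v Matrix.col (transpose_mat Q0) k"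
        using 1 by (intro col_mult2[OF M Q0tc])
      also have "Matrix.col (transpose_mat Q0) k = q k" using 1 Q0 by (simp add: q_def)
      finally have "q l \<bullet> (M *\<^sub>v q k) = mat_diag ?m d $$ (l, k)"
        using 1 unfolding Q0MQ0t by (simp add: q_def)
      thus ?thesis using 1 by (simp add: d'_def mat_diag_def)
    next
      case 2
      thus ?thesis using Mq[of k] q[of l] by (simp add: d'_def)
    next
      case 3
      have "q l \<bullet> (M *\<^sub>v q k) = (M *\<^sub>v q l) \<bullet> q k"
        using transpose_vec_mult_scalar[OF M q[of k] q[of l]] sym by simp
      thus ?thesis using Mq[of l] 3 q[of k] by auto
    qed
  qed
  define Q where "Q = mat\<^sub>r n n q"
  have Q: "Q \<in> carrier_mat n n" by (simp add: Q_def)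
  have Qt: "transpose_mat Q \<in> carrier_mat n n" using Q by simp
  have row: "Matrix.row Q l = q l" if "l < n" for l
    unfolding Q_def using that q[of l] by (intro row_mat_of_row_fun) auto
  have col: "Matrix.col (transpose_mat Q) l = q l" if "l < n" for l
    using row[OF that] that Q by simp
  have QQt: "Q * transpose_mat Q = 1\<^sub>m n"
    by (rule eq_matI) (use Q in \<open>auto simp: row qq\<close>)
  have QtQ: "transpose_mat Q * Q = 1\<^sub>m n"
    by (rule mat_mult_left_right_inverse[OF Q Qt QQt])
  have QMQt: "Q * (M * transpose_mat Q) = mat_diag n d'"
  proof (rule eq_matI)
    fix l k assume "l < dim_row (mat_diag n d')" "k < dim_col (mat_diag n d')"
    hence lk: "l < n" "k < n" by (auto simp: mat_diag_def)
    have "(Q * (M * transpose_mat Q)) $$ (l, k) = q l \<bullet> Matrix.col (M * transpose_mat Q) k"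
      using lk Q M by (simp add: row)
    also have "Matrix.col (M * transpose_mat Q) k = M *\<^sub>v q k"
      unfolding col[OF lk(2), symmetric] using lk by (intro col_mult2[OF M Qt])
    also have "q l \<bullet> (M *\<^sub>v q k) = mat_diag n d' $$ (l, k)"
      unfolding qMq[OF lk] using lk by (simp add: mat_diag_def)
    finally show "(Q * (M * transpose_mat Q)) $$ (l, k) = mat_diag n d' $$ (l, k)" .
  qed (use Q in \<open>auto simp: mat_diag_def\<close>)
  have D: "mat_diag n d' \<in> carrier_mat n n" by simp
  have Meq: "M = transpose_mat Q * mat_diag n d' * Q"
  proof -
    have "transpose_mat Q * mat_diag n d' = (transpose_mat Q * Q) * (M * transpose_mat Q)"
      unfolding QMQt[symmetric] by (rule assoc_mult_mat[OF Qt Q mult_carrier_mat[OF M Qt], symmetric])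
    also have "\<dots> = M * transpose_mat Q" unfolding QtQ using M Qt by simp
    finally have "transpose_mat Q * mat_diag n d' * Q = M * (transpose_mat Q * Q)"
      using assoc_mult_mat[OF M Qt Q] by simp
    thus ?thesis unfolding QtQ using M by simp
  qed
  have "similar_mat M (mat_diag n d')"
    by (rule similar_matI[OF _ QtQ QQt Meq]) (use M Q D in simp)
  hence "real_eigenvalues M = mset (map d' [0..<n])"
    unfolding real_eigenvalues_def by (simp only: char_poly_similar char_poly_mat_diag proots_linear_factors)
  also have "[0..<n] = [0..<?m] @ [?m]"
    using n upt_Suc_append[of 0 ?m] by simp
  also have "mset (map d' ([0..<?m] @ [?m])) = add_mset 0 (mset (map d [0..<?m]))"
  proof -
    have "map d' [0..<?m] = map d [0..<?m]" by (simp add: d'_def)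
    thus ?thesis by (simp add: d'_def del: map_eq_conv)
  qed
  finally have ev: "real_eigenvalues M = add_mset 0 (mset (map d [0..<?m]))" .
  have form: "x \<bullet> (M *\<^sub>v x) = (\<Sum>l<?m. d l * (q l \<bullet> x)^2)" if x: "x \<in> carrier_vec n" for x
  proof -
    have Qx: "Q *\<^sub>v x \<in> carrier_vec n" using Q x by simp
    have DQx: "mat_diag n d' *\<^sub>v (Q *\<^sub>v x) \<in> carrier_vec n" by (rule mult_mat_vec_carrier[OF D Qx])
    have "M *\<^sub>v x = transpose_mat Q *\<^sub>v (mat_diag n d' *\<^sub>v (Q *\<^sub>v x))"
      by (subst Meq) (simp only: assoc_mult_mat_vec[OF mult_carrier_mat[OF Qt D] Q x]
          assoc_mult_mat_vec[OF Qt D Qx])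
    hence "x \<bullet> (M *\<^sub>v x) = (Q *\<^sub>v x) \<bullet> (mat_diag n d' *\<^sub>v (Q *\<^sub>v x))"
      using transpose_vec_mult_scalar[OF Qt DQx x] by simp
    also have "\<dots> = (\<Sum>l = 0..<n. (q l \<bullet> x) * (mat_diag n d' *\<^sub>v (Q *\<^sub>v x)) $ l)"
      unfolding scalar_prod_def[of "Q *\<^sub>v x"] carrier_vecD[OF DQx]
      by (rule sum.cong) (use Q in \<open>auto simp: row simp del: index_mult_mat_vec simp: index_mult_mat_vec[of _ Q]\<close>)
    also have "\<dots> = (\<Sum>l = 0..<n. d' l * (q l \<bullet> x)^2)"
    proof (rule sum.cong)
      fix l assume "l \<in> {0..<n}"
      hence l: "l < n" by simp
      have "(mat_diag n d' *\<^sub>v (Q *\<^sub>v x)) $ l = (\<Sum>k = 0..<n. (if l = k then d' k else 0) * (Q *\<^sub>v x) $ k)"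
        using l Q by (simp add: scalar_prod_def mat_diag_def)
      also have "\<dots> = (\<Sum>k = 0..<n. if k = l then d' l * (q l \<bullet> x) else 0)"
        using Q l by (intro sum.cong) (auto simp: row)
      also have "\<dots> = d' l * (q l \<bullet> x)" using l by simp
      finally show "(q l \<bullet> x) * (mat_diag n d' *\<^sub>v (Q *\<^sub>v x)) $ l = d' l * (q l \<bullet> x)^2"
        by (simp add: power2_eq_square)
    qed simp
    also have "\<dots> = (\<Sum>l<Suc ?m. d' l * (q l \<bullet> x)^2)" using n by (simp add: atLeast0LessThan)
    also have "\<dots> = (\<Sum>l<?m. d' l * (q l \<bullet> x)^2)" unfolding sum.lessThan_Suc by (simp add: d'_def)
    also have "\<dots> = (\<Sum>l<?m. d l * (q l \<bullet> x)^2)" by (rule sum.cong) (simp_all add: d'_def)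
    finally show ?thesis .
  qed
  show thesis by (rule that[OF q ev detA form])
qed

subsection \<open>The Jacobian of the ring\<close>

lemma cyclic_succ_pred:
  fixes i n :: nat
  assumes "i < n"
  shows "(i + 1) mod n < n" "(i + n - 1) mod n < n"
    "((i + 1) mod n + n - 1) mod n = i" "((i + n - 1) mod n + 1) mod n = i"
proof -
  show "(i + 1) mod n < n" "(i + n - 1) mod n < n" using assms by auto
  show "((i + 1) mod n + n - 1) mod n = i"
    using assms by (cases "i + 1 = n") auto
  show "((i + n - 1) mod n + 1) mod n = i"
  proof (cases i)
    case 0
    thus ?thesis using assms by (cases n) auto
  next
    case (Suc j)
    hence "i + n - 1 = j + n" by simp
    hence "(i + n - 1) mod n = j" using Suc assms by simp
    thus ?thesis using Suc assms by simp
  qed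
qed

text \<open>Summation by parts on the ring: reindexing along the successor undoes the predecessor,
  so a shift moves from one argument of \<open>f\<close> to the other.\<close>

lemma sum_cyclic_shift:
  fixes f :: "nat \<Rightarrow> nat \<Rightarrow> 'a::comm_monoid_add"
  shows "(\<Sum>i<n. f i ((i + n - 1) mod n)) = (\<Sum>i<n. f ((i + 1) mod n) i)"
proof -
  have "bij_betw (\<lambda>i. (i + 1) mod n) {..<n} {..<n}"
    by (rule bij_betw_byWitness[where f' = "\<lambda>i. (i + n - 1) mod n"])
      (use cyclic_succ_pred[of _ n] in auto)
  from sum.reindex_bij_betw[OF this, of "\<lambda>i. f i ((i + n - 1) mod n)", symmetric]
  show ?thesis using cyclic_succ_pred(3)[of _ n] by simp
qed

lemma angle_diff_index: "i < n \<Longrightarrow> angle_diff n x $ i = x $ ((i + 1) mod n) - x $ i"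
  by (simp add: angle_diff_def)

lemma kuramoto_g_index:
  "i < n \<Longrightarrow> kuramoto_g n \<gamma> \<theta> $ i = - \<gamma> $ i * sin (angle_diff n \<theta> $ i)
     + \<gamma> $ ((i + n - 1) mod n) * sin (angle_diff n \<theta> $ ((i + n - 1) mod n))"
  by (simp add: kuramoto_g_def)

lemma kuramoto_jacobian_carrier: "kuramoto_jacobian n \<gamma> \<theta> \<in> carrier_mat n n"
  by (simp add: kuramoto_jacobian_def)

lemma kuramoto_g_carrier: "kuramoto_g n \<gamma> \<theta> \<in> carrier_vec n"
  by (simp add: kuramoto_g_def)

lemma kuramoto_g_chain:
  assumes c: "\<And>i. i < n \<Longrightarrow> ((\<lambda>s. c s $ i) has_real_derivative c' $ i) (at t within S)"
    and c': "c' \<in> carrier_vec n" and i: "i < n"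
  shows "((\<lambda>s. kuramoto_g n \<gamma> (c s) $ i) has_real_derivative (kuramoto_jacobian n \<gamma> (c t) *\<^sub>v c') $ i) (at t within S)"
proof -
  have "trigpoly n (\<lambda>\<phi>. kuramoto_g n \<gamma> \<phi> $ i)"
    using trigpoly_kuramoto_g i by (simp add: trigpoly_vec_def)
  from trigpoly_partial_deriv_chain(2)[OF this c]
  have "((\<lambda>s. kuramoto_g n \<gamma> (c s) $ i) has_real_derivative
     (\<Sum>k<n. partial_deriv n (\<lambda>\<phi>. kuramoto_g n \<gamma> \<phi> $ i) k (c t) * c' $ k)) (at t within S)" by simp
  also have "(\<Sum>k<n. partial_deriv n (\<lambda>\<phi>. kuramoto_g n \<gamma> \<phi> $ i) k (c t) * c' $ k) =
      (kuramoto_jacobian n \<gamma> (c t) *\<^sub>v c') $ i"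
    using i c' by (simp add: kuramoto_jacobian_def scalar_prod_def atLeast0LessThan)
  finally show ?thesis .
qed

text \<open>The derivative of g along the line from \<theta> in direction x is computed twice, by
  the explicit formula and by the chain rule, and derivatives are unique. Working with a whole
  direction rather than single entries spares case distinctions on neighbouring indices.\<close>

lemma kuramoto_jacobian_mult:
  assumes \<theta>: "\<theta> \<in> carrier_vec n" and x: "x \<in> carrier_vec n" and i: "i < n"
  shows "(kuramoto_jacobian n \<gamma> \<theta> *\<^sub>v x) $ i =
    - \<gamma> $ i * (cos (angle_diff n \<theta> $ i) * angle_diff n x $ i)
    + \<gamma> $ ((i + n - 1) mod n) *
      (cos (angle_diff n \<theta> $ ((i + n - 1) mod n)) * angle_diff n x $ ((i + n - 1) mod n))"
proof -
  define c where "c s = \<theta> + s \<cdot>\<^sub>v x" for s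
  have dim: "dim_vec \<theta> = n" "dim_vec x = n" using \<theta> x by auto
  have c0: "c 0 = \<theta>" using \<theta> x by (intro eq_vecI) (auto simp: c_def)
  have c: "((\<lambda>s. c s $ k) has_real_derivative x $ k) (at t)" if "k < n" for k t
  proof -
    have "c s $ k = \<theta> $ k + s * x $ k" for s using that by (simp add: c_def dim)
    thus ?thesis by (auto intro!: derivative_eq_intros)
  qed
  have ad: "((\<lambda>s. sin (angle_diff n (c s) $ k)) has_real_derivative
      cos (angle_diff n \<theta> $ k) * angle_diff n x $ k) (at 0)" if k: "k < n" for k
  proof -
    have "((\<lambda>s. angle_diff n (c s) $ k) has_real_derivative angle_diff n x $ k) (at 0)"
      unfolding angle_diff_index[OF k]
      using c[OF cyclic_succ_pred(1)[OF k]] c[OF k] by (rule DERIV_diff)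
    from DERIV_chain'[OF this DERIV_sin] show ?thesis unfolding c0 .
  qed
  let ?j = "(i + n - 1) mod n"
  have "((\<lambda>s. kuramoto_g n \<gamma> (c s) $ i) has_real_derivative
      - \<gamma> $ i * (cos (angle_diff n \<theta> $ i) * angle_diff n x $ i)
      + \<gamma> $ ?j * (cos (angle_diff n \<theta> $ ?j) * angle_diff n x $ ?j)) (at 0)"
    unfolding kuramoto_g_index[OF i]
    by (intro DERIV_add DERIV_cmult ad i cyclic_succ_pred(2))
  moreover have "((\<lambda>s. kuramoto_g n \<gamma> (c s) $ i) has_real_derivative
      (kuramoto_jacobian n \<gamma> \<theta> *\<^sub>v x) $ i) (at 0)"
    using kuramoto_g_chain[OF c x i, where \<gamma>=\<gamma> and t=0] unfolding c0 .
  ultimately show ?thesis by (rule DERIV_unique[symmetric])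
qed

text \<open>The Jacobian is a weighted Laplacian of the cycle, B^T W B with B the operator
  \<open>angle_diff\<close> and W = diag(\<gamma>_i cos \<eta>_i); summation by parts moves B onto
  y. Symmetry, the range orthogonal to \<open>ones\<close> and the inertia are all read off from
  this form.\<close>

lemma kuramoto_jacobian_form:
  assumes \<theta>: "\<theta> \<in> carrier_vec n" and x: "x \<in> carrier_vec n" and y: "y \<in> carrier_vec n"
  shows "y \<bullet> (kuramoto_jacobian n \<gamma> \<theta> *\<^sub>v x) =
    (\<Sum>i<n. \<gamma> $ i * cos (angle_diff n \<theta> $ i) * angle_diff n y $ i * angle_diff n x $ i)"
proof -
  define a where "a i = \<gamma> $ i * cos (angle_diff n \<theta> $ i) * angle_diff n x $ i" for i
  have Jx: "kuramoto_jacobian n \<gamma> \<theta> *\<^sub>v x \<in> carrier_vec n"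
    by (rule mult_mat_vec_carrier[OF kuramoto_jacobian_carrier x])
  have "y \<bullet> (kuramoto_jacobian n \<gamma> \<theta> *\<^sub>v x) = (\<Sum>i<n. y $ i * (kuramoto_jacobian n \<gamma> \<theta> *\<^sub>v x) $ i)"
    unfolding scalar_prod_def carrier_vecD[OF Jx] atLeast0LessThan ..
  also have "\<dots> = (\<Sum>i<n. y $ i * a ((i + n - 1) mod n) - y $ i * a i)"
    by (rule sum.cong) (simp_all add: kuramoto_jacobian_mult[OF \<theta> x] a_def algebra_simps del: index_mult_mat_vec)
  also have "\<dots> = (\<Sum>i<n. y $ ((i + 1) mod n) * a i) - (\<Sum>i<n. y $ i * a i)"
    unfolding sum_subtractf using sum_cyclic_shift[of "\<lambda>i j. y $ i * a j" n] by simp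
  also have "\<dots> = (\<Sum>i<n. angle_diff n y $ i * a i)"
    unfolding sum_subtractf[symmetric]
    by (rule sum.cong) (simp_all add: angle_diff_index left_diff_distrib)
  also have "\<dots> = (\<Sum>i<n. \<gamma> $ i * cos (angle_diff n \<theta> $ i) * angle_diff n y $ i * angle_diff n x $ i)"
    by (rule sum.cong) (simp_all add: a_def)
  finally show ?thesis .
qed

lemma angle_diff_ones: "i < n \<Longrightarrow> angle_diff n (ones n) $ i = 0"
  by (simp add: angle_diff_index cyclic_succ_pred(1)[of i n, simplified] ones_def)

lemma ones_carrier: "ones n \<in> carrier_vec n"
  by (simp add: ones_def)

lemma kuramoto_jacobian_symmetric:
  assumes \<theta>: "\<theta> \<in> carrier_vec n"
  shows "transpose_mat (kuramoto_jacobian n \<gamma> \<theta>) = kuramoto_jacobian n \<gamma> \<theta>"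
proof (rule eq_matI)
  let ?J = "kuramoto_jacobian n \<gamma> \<theta>"
  have J: "?J \<in> carrier_mat n n" by (rule kuramoto_jacobian_carrier)
  have entry: "?J $$ (i, j) = unit_vec n i \<bullet> (?J *\<^sub>v unit_vec n j)" if "i < n" "j < n" for i j
    using that J by (simp add: mult_mat_vec_carrier[OF J])
  fix i j assume "i < dim_row ?J" "j < dim_col ?J"
  hence ij: "i < n" "j < n" using J by auto
  have "?J $$ (j, i) = ?J $$ (i, j)"
    unfolding entry[OF ij] entry[OF ij(2,1)] kuramoto_jacobian_form[OF \<theta> unit_vec_carrier unit_vec_carrier]
    by (simp add: mult_ac)
  thus "transpose_mat ?J $$ (i, j) = ?J $$ (i, j)" using ij J by simp
qed (simp_all add: kuramoto_jacobian_def)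

lemma kuramoto_jacobian_ones:
  assumes \<theta>: "\<theta> \<in> carrier_vec n"
  shows "kuramoto_jacobian n \<gamma> \<theta> *\<^sub>v ones n = 0\<^sub>v n"
proof (rule eq_vecI)
  fix i assume "i < dim_vec (0\<^sub>v n :: real Matrix.vec)"
  hence i: "i < n" by simp
  show "(kuramoto_jacobian n \<gamma> \<theta> *\<^sub>v ones n) $ i = 0\<^sub>v n $ i"
    unfolding kuramoto_jacobian_mult[OF \<theta> ones_carrier i]
      angle_diff_ones[OF i] angle_diff_ones[OF cyclic_succ_pred(2)[OF i]] using i by simp
qed (simp add: kuramoto_jacobian_def)

lemma kuramoto_jacobian_mult_perp_ones:
  assumes "\<theta> \<in> carrier_vec n" "x \<in> carrier_vec n"
  shows "(kuramoto_jacobian n \<gamma> \<theta> *\<^sub>v x) \<bullet> ones n = 0"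
proof -
  have "(kuramoto_jacobian n \<gamma> \<theta> *\<^sub>v x) \<bullet> ones n = ones n \<bullet> (kuramoto_jacobian n \<gamma> \<theta> *\<^sub>v x)"
    by (rule comm_scalar_prod[OF mult_mat_vec_carrier[OF kuramoto_jacobian_carrier assms(2)] ones_carrier])
  also have "\<dots> = 0"
    unfolding kuramoto_jacobian_form[OF assms ones_carrier] by (simp add: angle_diff_ones)
  finally show ?thesis .
qed

lemma kuramoto_g_perp_ones: "kuramoto_g n \<gamma> \<theta> \<bullet> ones n = 0"
proof -
  define a where "a i = \<gamma> $ i * sin (angle_diff n \<theta> $ i)" for i
  have "kuramoto_g n \<gamma> \<theta> \<bullet> ones n = (\<Sum>i<n. a ((i + n - 1) mod n) - a i)"
    unfolding scalar_prod_def
    by (intro sum.cong) (auto simp: ones_def kuramoto_g_index a_def)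
  also have "\<dots> = 0"
    unfolding sum_subtractf using sum_cyclic_shift[of "\<lambda>i j. a j" n] by simp
  finally show ?thesis .
qed

text \<open>On the complement of \<open>ones\<close> the Jacobian is represented by A = P J P^T,
  where A adj(A) = det(A) 1. Both g and the range of J lie in that complement, on which P^T P acts
  as the identity, so the relation lifts from A to J.\<close>

lemma kuramoto_jacobian_v_field:
  assumes onb: "onb_ones_perp n P" and \<theta>: "\<theta> \<in> carrier_vec n"
  shows "kuramoto_jacobian n \<gamma> \<theta> *\<^sub>v v_field n P \<gamma> \<theta> =
    (- det_red P (kuramoto_jacobian n \<gamma> \<theta>)) \<cdot>\<^sub>v kuramoto_g n \<gamma> \<theta>"
proof -
  let ?J = "kuramoto_jacobian n \<gamma> \<theta>" and ?g = "kuramoto_g n \<gamma> \<theta>"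
  note P = onb_ones_perpD(1)[OF onb] and proj = onb_ones_perpD(4)[OF onb]
  have Pt: "transpose_mat P \<in> carrier_mat n (n - 1)" using P by simp
  note J = kuramoto_jacobian_carrier[of n \<gamma> \<theta>] and g = kuramoto_g_carrier[of n \<gamma> \<theta>]
  define A where "A = P * ?J * transpose_mat P"
  have A: "A \<in> carrier_mat (n - 1) (n - 1)"
    unfolding A_def by (rule mult_carrier_mat[OF mult_carrier_mat[OF P J] Pt])
  note adj = adj_mat(1)[OF A]
  have Pg: "P *\<^sub>v ?g \<in> carrier_vec (n - 1)" by (rule mult_mat_vec_carrier[OF P g])
  define c where "c = adj_mat A *\<^sub>v (P *\<^sub>v ?g)"
  have c: "c \<in> carrier_vec (n - 1)" unfolding c_def by (rule mult_mat_vec_carrier[OF adj Pg])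
  have Ptc: "transpose_mat P *\<^sub>v c \<in> carrier_vec n" by (rule mult_mat_vec_carrier[OF Pt c])
  have Ac: "A *\<^sub>v c = Determinant.det A \<cdot>\<^sub>v (P *\<^sub>v ?g)"
  proof -
    have "A *\<^sub>v c = (A * adj_mat A) *\<^sub>v (P *\<^sub>v ?g)"
      unfolding c_def by (rule assoc_mult_mat_vec[OF A adj Pg, symmetric])
    also have "\<dots> = Determinant.det A \<cdot>\<^sub>v (P *\<^sub>v ?g)"
    proof -
      have "(k \<cdot>\<^sub>m 1\<^sub>m m) *\<^sub>v y = k \<cdot>\<^sub>v y" if "y \<in> carrier_vec m" for k :: real and m y
      proof (rule eq_vecI)
        fix i assume "i < dim_vec (k \<cdot>\<^sub>v y)"
        hence i: "i < m" using that by simp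
        thus "((k \<cdot>\<^sub>m 1\<^sub>m m) *\<^sub>v y) $ i = (k \<cdot>\<^sub>v y) $ i"
          using scalar_prod_left_unit[OF that i] smult_scalar_prod_distrib[OF unit_vec_carrier that] that by simp
      qed (use that in simp)
      from this[OF Pg] show ?thesis unfolding adj_mat(2)[OF A] .
    qed
    finally show ?thesis .
  qed
  have "?J *\<^sub>v (transpose_mat P *\<^sub>v c) = transpose_mat P *\<^sub>v (P *\<^sub>v (?J *\<^sub>v (transpose_mat P *\<^sub>v c)))"
    by (rule proj[symmetric, OF mult_mat_vec_carrier[OF J Ptc] kuramoto_jacobian_mult_perp_ones[OF \<theta> Ptc]])
  also have "P *\<^sub>v (?J *\<^sub>v (transpose_mat P *\<^sub>v c)) = A *\<^sub>v c"
    unfolding A_def assoc_mult_mat_vec[OF mult_carrier_mat[OF P J] Pt c]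
    by (rule assoc_mult_mat_vec[OF P J Ptc, symmetric])
  also have "transpose_mat P *\<^sub>v (A *\<^sub>v c) = Determinant.det A \<cdot>\<^sub>v (transpose_mat P *\<^sub>v (P *\<^sub>v ?g))"
    unfolding Ac by (rule mult_mat_vec[OF Pt Pg])
  also have "transpose_mat P *\<^sub>v (P *\<^sub>v ?g) = ?g" by (rule proj[OF g kuramoto_g_perp_ones])
  finally have *: "?J *\<^sub>v (transpose_mat P *\<^sub>v c) = Determinant.det A \<cdot>\<^sub>v ?g" .
  have v: "v_field n P \<gamma> \<theta> = (- 1) \<cdot>\<^sub>v (transpose_mat P *\<^sub>v c)"
    unfolding v_field_def c_def A_def by (rule eq_vecI) auto
  show ?thesis
    unfolding v mult_mat_vec[OF J Ptc] * by (rule eq_vecI) (auto simp: det_red_def A_def)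
qed

text \<open>The displacement \<open>x\<close> is present because the Jacobian differentiates along
  the lines \<theta> + t e_k, so invariance is required at displaced points too.\<close>

lemma angle_diff_shift:
  assumes "\<theta> \<in> carrier_vec n" "\<theta>' \<in> carrier_vec n" "\<theta> - \<theta>' = c \<cdot>\<^sub>v ones n"
    and "x \<in> carrier_vec n"
  shows "angle_diff n (\<theta> + x) = angle_diff n (\<theta>' + x)"
proof (rule eq_vecI)
  have dim: "dim_vec \<theta> = n" "dim_vec \<theta>' = n" "dim_vec x = n" using assms by auto
  have d: "\<theta> $ k = \<theta>' $ k + c" if "k < n" for k
    using arg_cong[OF assms(3), of "\<lambda>v. v $ k"] that dim by (simp add: ones_def)
  fix i assume "i < dim_vec (angle_diff n (\<theta>' + x))"
  hence i: "i < n" by (simp add: angle_diff_def)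
  show "angle_diff n (\<theta> + x) $ i = angle_diff n (\<theta>' + x) $ i"
    using d[OF i] d[OF cyclic_succ_pred(1)[OF i]] i cyclic_succ_pred(1)[OF i] dim
    by (simp add: angle_diff_index)
qed (simp add: angle_diff_def)

text \<open>This separates the branches: solutions that differ by a multiple of \<open>ones\<close>
  have the same reduced determinant, whereas its signs on the two branches are opposite.\<close>

lemma kuramoto_jacobian_shift:
  assumes "\<theta> \<in> carrier_vec n" "\<theta>' \<in> carrier_vec n" "\<theta> - \<theta>' = c \<cdot>\<^sub>v ones n"
  shows "kuramoto_jacobian n \<gamma> \<theta> = kuramoto_jacobian n \<gamma> \<theta>'"
proof -
  have "angle_diff n (\<theta> + t \<cdot>\<^sub>v unit_vec n k) = angle_diff n (\<theta>' + t \<cdot>\<^sub>v unit_vec n k)" for t k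
    by (rule angle_diff_shift[OF assms]) simp
  thus ?thesis
    unfolding kuramoto_jacobian_def partial_deriv_def kuramoto_g_def by simp
qed

text \<open>The quadratic form of the Jacobian is the restriction of a diagonal form with \<open>n\<close> entries
  to a hyperplane, so each of its two inertia indices drops by at most one; since their sum is
  \<open>n - 1\<close>, the sign of the reduced determinant decides which of them drops.\<close>

lemma kuramoto_eigenvalues:
  assumes n: "n \<ge> 1" and onb: "onb_ones_perp n P" and \<theta>: "\<theta> \<in> carrier_vec n"
    and \<gamma>: "\<forall>i<n. \<gamma> $ i > 0" and cos: "\<forall>i<n. cos (angle_diff n \<theta> $ i) \<noteq> 0"
    and det: "det_red P (kuramoto_jacobian n \<gamma> \<theta>) \<noteq> 0"
  obtains E where "real_eigenvalues (kuramoto_jacobian n \<gamma> \<theta>) = add_mset 0 E" "0 \<notin># E" "size E = n - 1"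
    "num_pos_eigenvalues (kuramoto_jacobian n \<gamma> \<theta>) = size {#x \<in># E. x > 0#}"
    "(- 1) ^ (n - num_pos_cos n \<theta>) * det_red P (kuramoto_jacobian n \<gamma> \<theta>) > 0 \<Longrightarrow>
      size {#x \<in># E. x > 0#} + 1 = num_pos_cos n \<theta>"
    "(- 1) ^ (n - num_pos_cos n \<theta>) * det_red P (kuramoto_jacobian n \<gamma> \<theta>) < 0 \<Longrightarrow>
      size {#x \<in># E. x > 0#} = num_pos_cos n \<theta>"
proof -
  let ?J = "kuramoto_jacobian n \<gamma> \<theta>" and ?m = "n - 1"
  obtain d u where u: "\<And>l. l < ?m \<Longrightarrow> u l \<in> carrier_vec n"
    and ev: "real_eigenvalues ?J = add_mset 0 (mset (map d [0..<?m]))"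
    and prod: "(\<Prod>l<?m. d l) = det_red P ?J"
    and form: "\<And>x. x \<in> carrier_vec n \<Longrightarrow> x \<bullet> (?J *\<^sub>v x) = (\<Sum>l<?m. d l * (u l \<bullet> x)^2)"
    by (rule det_red_spectral[OF onb n kuramoto_jacobian_carrier kuramoto_jacobian_symmetric[OF \<theta>]
        kuramoto_jacobian_ones[OF \<theta>]]) (rule that)
  define E where "E = mset (map d [0..<?m])"
  have dnz: "d l \<noteq> 0" if "l < ?m" for l
    using det that unfolding prod[symmetric] by auto
  have E0: "0 \<notin># E" using dnz by (auto simp: E_def)
  have sizeE: "size E = ?m" by (simp add: E_def)
  define p where "p = card {l. l < ?m \<and> d l > 0}"
  define q where "q = card {l. l < ?m \<and> d l < 0}"
  have pE: "size {#x \<in># E. x > 0#} = p"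
  proof -
    have "{#x \<in># E. x > 0#} = image_mset d (mset_set {l \<in> {0..<?m}. d l > 0})"
      unfolding E_def by (simp add: filter_mset_image_mset)
    thus ?thesis by (simp add: p_def)
  qed
  have np: "num_pos_eigenvalues ?J = p"
    unfolding num_pos_eigenvalues_def ev E_def[symmetric] by (simp add: pE)
  define w where "w i = \<gamma> $ i * cos (angle_diff n \<theta> $ i)" for i
  \<comment> \<open>Row i of the incidence matrix of the cycle: pairing with x gives the i-th angle
    difference of x, so the form becomes a sum of \<open>n\<close> weighted squares.\<close>
  define r where "r i = (unit_vec n ((i + 1) mod n) - unit_vec n i :: real Matrix.vec)" for i
  have r: "r i \<in> carrier_vec n" for i by (simp add: r_def)
  have rx: "r i \<bullet> x = angle_diff n x $ i" if "i < n" "x \<in> carrier_vec n" for i x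
    unfolding r_def using that cyclic_succ_pred(1)[OF that(1)]
    by (simp add: minus_scalar_prod_distrib[of _ n] angle_diff_index)
  have form': "(\<Sum>l<?m. d l * (u l \<bullet> x)^2) = (\<Sum>i<n. w i * (r i \<bullet> x)^2)" if "x \<in> carrier_vec n" for x
    unfolding form[OF that, symmetric] kuramoto_jacobian_form[OF \<theta> that that]
    by (rule sum.cong) (simp_all add: rx that w_def power2_eq_square)
  \<comment> \<open>Vanishing angle differences make x constant, so the common kernel of the
    \<open>r i\<close> is spanned by \<open>ones\<close>; pairing with \<open>ones\<close> is
    therefore the right functional \<open>q\<close>.\<close>
  have zero: "x = 0\<^sub>v n" if x: "x \<in> carrier_vec n" and rx0: "\<And>i. i < n \<Longrightarrow> r i \<bullet> x = 0" and ox: "ones n \<bullet> x = 0" for x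
  proof -
    have const: "x $ i = x $ 0" if "i < n" for i
      using that
    proof (induction i)
      case (Suc i)
      have "r i \<bullet> x = 0" using rx0 Suc.prems by simp
      thus ?case using rx[of i x] Suc x by (simp add: angle_diff_index)
    qed simp
    have "ones n \<bullet> x = (\<Sum>i = 0..<n. x $ i)" using x by (auto simp: scalar_prod_def ones_def intro!: sum.cong)
    also have "\<dots> = (\<Sum>i = 0..<n. x $ 0)" by (rule sum.cong, simp, rule const, simp)
    finally have x0: "x $ 0 = 0" using ox n by simp
    show ?thesis
      by (rule eq_vecI) (use const[unfolded x0] x in auto)
  qed
  have P: "card {i. i < n \<and> w i \<le> 0} = n - num_pos_cos n \<theta>" "card {i. i < n \<and> w i > 0} = num_pos_cos n \<theta>"
    "num_pos_cos n \<theta> \<le> n"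
  proof -
    have pos: "{i. i < n \<and> w i > 0} = {i. i < n \<and> cos (angle_diff n \<theta> $ i) > 0}"
      using \<gamma> by (auto simp: w_def zero_less_mult_iff)
    show 1: "card {i. i < n \<and> w i > 0} = num_pos_cos n \<theta>"
      unfolding pos num_pos_cos_def ..
    have "{i. i < n \<and> w i \<le> 0} = {..<n} - {i. i < n \<and> w i > 0}" by auto
    moreover have "card \<dots> = card {..<n} - card {i. i < n \<and> w i > 0}"
      by (rule card_Diff_subset) auto
    ultimately show "card {i. i < n \<and> w i \<le> 0} = n - num_pos_cos n \<theta>" using 1 by simp
    show "num_pos_cos n \<theta> \<le> n"
      unfolding 1[symmetric] using card_mono[of "{..<n}" "{i. i < n \<and> w i > 0}"] by auto
  qed
  have wnz: "w i \<noteq> 0" if "i < n" for i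
    using \<gamma> cos that by (force simp: w_def)
  have "n \<le> card {i. i < n \<and> w i \<le> 0} + card {l. l < ?m \<and> d l > 0} + 1"
  proof (rule inertia_bound)
    fix x :: "real Matrix.vec"
    assume x: "x \<in> carrier_vec n"
    show "(\<Sum>l<?m. d l * (u l \<bullet> x)^2) = (\<Sum>i<n. w i * (r i \<bullet> x)^2)" by (rule form'[OF x])
    assume "\<And>i. i < n \<Longrightarrow> r i \<bullet> x = 0" "ones n \<bullet> x = 0"
    with x show "x = 0\<^sub>v n" by (rule zero)
  qed (rule u r ones_carrier; assumption?)+
  hence b1: "n \<le> (n - num_pos_cos n \<theta>) + p + 1" unfolding P p_def .
  \<comment> \<open>The negated form bounds the number of negative eigenvalues from below in the
    same way.\<close>
  have "n \<le> card {i. i < n \<and> - w i \<le> 0} + card {l. l < ?m \<and> - d l > 0} + 1"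
  proof (rule inertia_bound)
    fix x :: "real Matrix.vec"
    assume x: "x \<in> carrier_vec n"
    show "(\<Sum>l<?m. - d l * (u l \<bullet> x)^2) = (\<Sum>i<n. - w i * (r i \<bullet> x)^2)"
      using form'[OF x] by (simp add: sum_negf)
    assume "\<And>i. i < n \<Longrightarrow> r i \<bullet> x = 0" "ones n \<bullet> x = 0"
    with x show "x = 0\<^sub>v n" by (rule zero)
  qed (rule u r ones_carrier; assumption?)+
  moreover have "{i. i < n \<and> - w i \<le> 0} = {i. i < n \<and> w i > 0}"
    using wnz by force
  ultimately have b2: "n \<le> num_pos_cos n \<theta> + q + 1" by (simp add: P q_def)
  have pq: "p + q = ?m"
  proof -
    have "{l. l < ?m \<and> d l > 0} \<union> {l. l < ?m \<and> d l < 0} = {..<?m}" using dnz by force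
    moreover have "card ({l. l < ?m \<and> d l > 0} \<union> {l. l < ?m \<and> d l < 0}) = p + q"
      unfolding p_def q_def by (rule card_Un_disjoint) auto
    ultimately show ?thesis by simp
  qed
  have sgn: "sgn (det_red P ?J) = (- 1) ^ q"
  proof -
    have "sgn (\<Prod>l<k. d l) = (\<Prod>l<k. sgn (d l))" for k
      by (induction k) (auto simp: sgn_mult)
    hence "sgn (det_red P ?J) = (\<Prod>l<?m. sgn (d l))"
      unfolding prod[symmetric] .
    also have "\<dots> = (\<Prod>l<?m. if d l < 0 then - 1 else 1)"
      by (rule prod.cong) (use dnz in \<open>auto simp: sgn_if\<close>)
    also have "\<dots> = (- 1) ^ card ({..<?m} \<inter> {l. d l < 0})"
      by (subst prod.If_cases) simp_all
    also have "{..<?m} \<inter> {l. d l < 0} = {l. l < ?m \<and> d l < 0}" by auto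
    finally show ?thesis by (simp add: q_def)
  qed
  let ?k = "num_pos_cos n \<theta>"
  have sgn': "sgn ((- 1) ^ (n - ?k) * det_red P ?J) = (- 1) ^ (n - ?k + q)"
  proof -
    have "sgn ((- 1) ^ m :: real) = (- 1) ^ m" for m :: nat by (cases "even m") auto
    thus ?thesis by (simp add: sgn_mult sgn power_add)
  qed
  \<comment> \<open>With k positive cosines, the first bound says k \<le> p + 1 and the second, by p
    + q = n - 1, says p \<le> k. The parity of n - k + q tells the two cases apart: it equals 2q if
    p = k - 1 and 2q + 1 if p = k.\<close>
  have cases: "p + 1 = ?k \<or> p = ?k" using b1 b2 pq P(3) n by linarith
  show thesis
  proof (rule that[of E])
    show "real_eigenvalues ?J = add_mset 0 E" by (simp add: ev E_def)
    show "num_pos_eigenvalues ?J = size {#x \<in># E. x > 0#}" by (simp add: np pE)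
    show "size {#x \<in># E. x > 0#} + 1 = ?k" if "(- 1) ^ (n - ?k) * det_red P ?J > 0"
    proof (rule ccontr)
      assume "\<not> ?thesis"
      hence "p = ?k" using cases pE by simp
      hence "n - ?k + q = 2 * q + 1" using pq n P(3) by linarith
      hence "(- 1 :: real) ^ (n - ?k + q) = - 1" by simp
      thus False using that sgn' by (simp add: sgn_if split: if_splits)
    qed
    show "size {#x \<in># E. x > 0#} = ?k" if "(- 1) ^ (n - ?k) * det_red P ?J < 0"
    proof (rule ccontr)
      assume "\<not> ?thesis"
      hence "p + 1 = ?k" using cases pE by simp
      hence "n - ?k + q = 2 * q" using pq n P(3) by linarith
      hence "(- 1 :: real) ^ (n - ?k + q) = 1" by simp
      thus False using that sgn' by (simp add: sgn_if split: if_splits)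
    qed
  qed (simp_all add: E0 sizeE)
qed

subsection \<open>The two branches\<close>

text \<open>Time runs forward only; the factor \<open>s\<close> gives access to the backward
  half-orbit as well.\<close>

lemma v_field_flow:
  fixes s :: real
  assumes P: "P \<in> carrier_mat m n" and \<theta>0: "\<theta>0 \<in> carrier_vec n"
  obtains h c where "h > 0" "c 0 = \<theta>0" "\<And>t. c t \<in> carrier_vec n"
    "\<And>t i. t \<in> {0..h} \<Longrightarrow> i < n \<Longrightarrow>
      ((\<lambda>t. c t $ i) has_real_derivative s * v_field n P \<gamma> (c t) $ i) (at t within {0..h})"
proof -
  \<comment> \<open>Picard's theorem needs a Banach space as a type: the vectors of length n are embedded into
    the bounded continuous functions on the line by interpolation at the integers.\<close>
  define vecof where "vecof x = Matrix.vec n (\<lambda>i. apply_bcontfun x (real i))" for x :: "real \<Rightarrow>\<^sub>C real"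
  \<comment> \<open>Tent functions centred at the integers. At integer points they are Kronecker
    deltas, so \<open>emb\<close> interpolates given values and \<open>vecof\<close> recovers
    them.\<close>
  define hat where "hat j x = max 0 (1 - \<bar>x - real j\<bar>)" for j :: nat and x
  have hat: "0 \<le> hat j x" "hat j x \<le> 1" "hat j (real i) = (if i = j then 1 else 0)" for i j x
    by (auto simp: hat_def)
  have bound: "\<bar>\<Sum>j<n. f j * hat j x\<bar> \<le> (\<Sum>j<n. \<bar>f j\<bar>)" for f x
  proof -
    have "\<bar>\<Sum>j<n. f j * hat j x\<bar> \<le> (\<Sum>j<n. \<bar>f j * hat j x\<bar>)" by (rule sum_abs)
    also have "\<dots> \<le> (\<Sum>j<n. \<bar>f j\<bar>)"
    proof (rule sum_mono)
      fix j show "\<bar>f j * hat j x\<bar> \<le> \<bar>f j\<bar>"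
        using mult_left_mono[OF hat(2)[of j x], of "\<bar>f j\<bar>"] hat(1)[of j x] by (simp add: abs_mult)
    qed
    finally show ?thesis .
  qed
  have bc: "(\<lambda>x. \<Sum>j<n. f j * hat j x) \<in> bcontfun" for f
  proof (rule bcontfun_normI)
    show "continuous_on UNIV (\<lambda>x. \<Sum>j<n. f j * hat j x)"
      unfolding hat_def by (intro continuous_intros)
    show "norm (\<Sum>j<n. f j * hat j x) \<le> (\<Sum>j<n. \<bar>f j\<bar>)" for x using bound[of f x] by simp
  qed
  define emb where "emb f = Bcontfun (\<lambda>x. \<Sum>j<n. f j * hat j x)" for f
  have emb: "apply_bcontfun (emb f) x = (\<Sum>j<n. f j * hat j x)" for f x
    unfolding emb_def by (simp add: Bcontfun_inverse[OF bc])
  have emb_nat: "apply_bcontfun (emb f) (real i) = f i" if "i < n" for f i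
    using that by (simp add: emb hat(3) if_distrib cong: if_cong)
  \<comment> \<open>The field reads x only at 0, ..., n - 1 and returns the interpolated velocity
    there, so evaluating a solution at these integers gives a curve in R^n that follows s v.\<close>
  define F where "F x = emb (\<lambda>i. s * v_field n P \<gamma> (vecof x) $ i)" for x
  have "\<exists>L. \<forall>\<theta> \<theta>' d. d \<ge> 0 \<longrightarrow> (\<forall>i<n. \<bar>\<theta> $ i - \<theta>' $ i\<bar> \<le> d) \<longrightarrow>
      \<bar>v_field n P \<gamma> \<theta> $ j - v_field n P \<gamma> \<theta>' $ j\<bar> \<le> L * d" if "j < n" for j
  proof -
    have tp: "trigpoly n (\<lambda>\<theta>. v_field n P \<gamma> \<theta> $ j)"
      using trigpoly_v_field[OF P] that by (simp add: trigpoly_vec_def)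
    show ?thesis
      using trigpoly_bounded_lipschitz[OF tp] by (elim exE conjE) (intro exI)
  qed
  then obtain L where L: "\<And>j \<theta> \<theta>' d. j < n \<Longrightarrow> d \<ge> 0 \<Longrightarrow> (\<forall>i<n. \<bar>\<theta> $ i - \<theta>' $ i\<bar> \<le> d) \<Longrightarrow>
      \<bar>v_field n P \<gamma> \<theta> $ j - v_field n P \<gamma> \<theta>' $ j\<bar> \<le> L j * d"
    by metis
  \<comment> \<open>An interpolant is bounded by the sum of the absolute values at its nodes, hence
    the sum of the coordinatewise Lipschitz constants.\<close>
  define K where "K = \<bar>s\<bar> * (\<Sum>j<n. L j)"
  have lip: "norm (F x - F y) \<le> K * norm (x - y)" for x y
  proof (rule norm_bound)
    fix z
    have v: "\<bar>v_field n P \<gamma> (vecof x) $ j - v_field n P \<gamma> (vecof y) $ j\<bar> \<le> L j * norm (x - y)" if "j < n" for j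
    proof (rule L[OF that], simp, intro allI impI)
      fix i assume "i < n"
      thus "\<bar>vecof x $ i - vecof y $ i\<bar> \<le> norm (x - y)"
        using norm_bounded[of "x - y" "real i"] by (simp add: vecof_def)
    qed
    have "norm (apply_bcontfun (F x - F y) z)
        = \<bar>\<Sum>j<n. (s * v_field n P \<gamma> (vecof x) $ j - s * v_field n P \<gamma> (vecof y) $ j) * hat j z\<bar>"
      by (simp add: F_def emb sum_subtractf left_diff_distrib)
    also have "\<dots> \<le> (\<Sum>j<n. \<bar>s * v_field n P \<gamma> (vecof x) $ j - s * v_field n P \<gamma> (vecof y) $ j\<bar>)"
      by (rule bound)
    also have "\<dots> = (\<Sum>j<n. \<bar>s\<bar> * \<bar>v_field n P \<gamma> (vecof x) $ j - v_field n P \<gamma> (vecof y) $ j\<bar>)"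
      by (simp add: abs_mult[symmetric] right_diff_distrib)
    also have "\<dots> \<le> (\<Sum>j<n. \<bar>s\<bar> * (L j * norm (x - y)))"
      by (intro sum_mono mult_left_mono v) auto
    also have "\<dots> = K * norm (x - y)"
      by (simp add: K_def sum_distrib_left sum_distrib_right mult.assoc)
    finally show "norm (apply_bcontfun (F x - F y) z) \<le> K * norm (x - y)" .
  qed
  obtain h x where h: "h > 0" and x0: "x 0 = emb (\<lambda>i. \<theta>0 $ i)"
    and x: "\<And>t. t \<in> {0..h} \<Longrightarrow> (x has_vector_derivative F (x t)) (at t within {0..h})"
    by (rule picard_lindeloef_lipschitz[OF lip]) (rule that)
  define c where "c t = vecof (x t)" for t
  have "c 0 = \<theta>0"
    by (rule eq_vecI) (use \<theta>0 in \<open>auto simp: c_def vecof_def x0 emb_nat\<close>)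
  moreover have "c t \<in> carrier_vec n" for t by (simp add: c_def vecof_def)
  moreover have "((\<lambda>t. c t $ i) has_real_derivative s * v_field n P \<gamma> (c t) $ i) (at t within {0..h})"
    if t: "t \<in> {0..h}" and i: "i < n" for t i
  proof -
    have bl: "bounded_linear (\<lambda>f :: real \<Rightarrow>\<^sub>C real. apply_bcontfun f (real i))"
      by (rule bounded_linear_intro[where K = 1]) (use norm_bounded[where 'a = real and 'b = real] in auto)
    from bounded_linear.has_vector_derivative[OF bl x[OF t]]
    have "((\<lambda>t. apply_bcontfun (x t) (real i)) has_real_derivative s * v_field n P \<gamma> (c t) $ i) (at t within {0..h})"
      using i by (simp add: has_real_derivative_iff_has_vector_derivative F_def emb_nat c_def)
    moreover have "c t $ i = apply_bcontfun (x t) (real i)" for t using i by (simp add: c_def vecof_def)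
    ultimately show ?thesis by simp
  qed
  ultimately show thesis using that[OF h, of c] by blast
qed

text \<open>This is the passage from time to the parameter \<sigma>. Since \<sigma> is stationary at
  time 0, the inverse function theorem does not reach the collision; compactness of the time
  interval makes the inverse continuous up to that end.\<close>

lemma strict_decreasing_inverse:
  fixes f :: "real \<Rightarrow> real"
  assumes h: "h > 0" and cont: "continuous_on {0..h} f"
    and dec: "\<And>a b. 0 \<le> a \<Longrightarrow> a < b \<Longrightarrow> b \<le> h \<Longrightarrow> f b < f a"
  obtains T where "continuous_on {f h..f 0} T" "T ` {f h..f 0} \<subseteq> {0..h}" "T (f 0) = 0"
    "\<And>y. y \<in> {f h..f 0} \<Longrightarrow> f (T y) = y"
proof -
  have inj: "inj_on f {0..h}"
  proof (rule linorder_inj_onI)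
    fix a b assume "a < b" "a \<in> {0..h}" "b \<in> {0..h}"
    thus "f a \<noteq> f b" using dec[of a b] by simp
  qed auto
  define T where "T = inv_into {0..h} f"
  have Tf: "T (f t) = t" if "t \<in> {0..h}" for t
    unfolding T_def by (rule inv_into_f_f[OF inj that])
  have mono: "f b \<le> f a" if "0 \<le> a" "a \<le> b" "b \<le> h" for a b
    using dec[of a b] that by (cases "a = b") auto
  have img: "f ` {0..h} = {f h..f 0}"
  proof
    show "f ` {0..h} \<subseteq> {f h..f 0}" using mono by auto
    show "{f h..f 0} \<subseteq> f ` {0..h}"
    proof
      fix y assume "y \<in> {f h..f 0}"
      then obtain t where "0 \<le> t" "t \<le> h" "f t = y"
        using IVT2'[of f h y 0] h cont by auto
      thus "y \<in> f ` {0..h}" by auto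
    qed
  qed
  have "continuous_on {f h..f 0} T"
    unfolding img[symmetric] by (rule continuous_on_inv[OF cont]) (use Tf in auto)
  moreover have "T ` {f h..f 0} \<subseteq> {0..h}"
    unfolding img[symmetric] using Tf by auto
  moreover have "f (T y) = y" if "y \<in> {f h..f 0}" for y
    using that unfolding img[symmetric] by (auto simp: Tf)
  moreover have "T (f 0) = 0" using Tf h by simp
  ultimately show thesis using that by blast
qed

text \<open>The condition \<open>s * s = 1\<close> encodes s = 1 or s = -1. Since s det_Red is
  negative along the result, \<open>s = - 1\<close> yields the branch with positive and
  \<open>s = 1\<close> the branch with negative reduced determinant.\<close>

lemma kuramoto_branch:
  fixes s :: real
  assumes onb: "onb_ones_perp n P" and \<theta>0: "\<theta>0 \<in> carrier_vec n"
    and det0: "det_red P (kuramoto_jacobian n \<gamma> \<theta>0) = 0"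
    and delta: "kuramoto_delta n P \<gamma> \<theta>0 < 0" and \<sigma>0: "\<sigma>0 > 0"
    and \<omega>: "\<omega> = \<sigma>0 \<cdot>\<^sub>v kuramoto_g n \<gamma> \<theta>0" and s: "s * s = 1"
  obtains \<epsilon> \<theta> where "\<epsilon> > 0"
    "\<And>i. i < n \<Longrightarrow> continuous_on {\<sigma>0 - \<epsilon>..\<sigma>0} (\<lambda>\<sigma>. \<theta> \<sigma> $ i)"
    "\<And>\<sigma>. \<sigma> \<in> {\<sigma>0 - \<epsilon>..\<sigma>0} \<Longrightarrow> phase_locked n \<omega> \<gamma> \<sigma> (\<theta> \<sigma>)"
    "\<theta> \<sigma>0 = \<theta>0"
    "\<And>\<sigma>. \<sigma> \<in> {\<sigma>0 - \<epsilon>..<\<sigma>0} \<Longrightarrow> s * det_red P (kuramoto_jacobian n \<gamma> (\<theta> \<sigma>)) < 0"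
proof -
  note P = onb_ones_perpD(1)[OF onb]
  obtain h0 c where h0: "h0 > 0" and c0: "c 0 = \<theta>0" and c: "\<And>t. c t \<in> carrier_vec n"
    and c': "\<And>t i. t \<in> {0..h0} \<Longrightarrow> i < n \<Longrightarrow>
      ((\<lambda>t. c t $ i) has_real_derivative s * v_field n P \<gamma> (c t) $ i) (at t within {0..h0})"
    by (rule v_field_flow[OF P \<theta>0, of s \<gamma>]) (rule that)
  define D where "D t = det_red P (kuramoto_jacobian n \<gamma> (c t))" for t
  have D': "(D has_real_derivative s * (n_field n P \<gamma> (c t) \<bullet> v_field n P \<gamma> (c t))) (at t within {0..h0})"
    if t: "t \<in> {0..h0}" for t
  proof -
    have v: "v_field n P \<gamma> (c t) \<in> carrier_vec n"
      using trigpoly_v_field[OF P] by (simp add: trigpoly_vec_def)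
    from trigpoly_partial_deriv_chain(2)[OF trigpoly_det_red[OF P, of \<gamma>] c'[OF t]]
    have "(D has_real_derivative (\<Sum>k<n. partial_deriv n (\<lambda>\<phi>. det_red P (kuramoto_jacobian n \<gamma> \<phi>)) k (c t)
        * (s * v_field n P \<gamma> (c t) $ k))) (at t within {0..h0})"
      unfolding D_def by simp
    also have "(\<Sum>k<n. partial_deriv n (\<lambda>\<phi>. det_red P (kuramoto_jacobian n \<gamma> \<phi>)) k (c t)
        * (s * v_field n P \<gamma> (c t) $ k)) = s * (n_field n P \<gamma> (c t) \<bullet> v_field n P \<gamma> (c t))"
      unfolding scalar_prod_def carrier_vecD[OF v] sum_distrib_left atLeast0LessThan
      by (rule sum.cong) (simp_all add: n_field_def partial_gradient_def)
    finally show ?thesis .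
  qed
  \<comment> \<open>The factor \<open>s\<close> enters twice, through the speed of the curve and
    through the prefactor, so the derivative at 0 is \<delta> for either sign.\<close>
  have "((\<lambda>t. s * D t) has_real_derivative s * (s * (n_field n P \<gamma> (c 0) \<bullet> v_field n P \<gamma> (c 0)))) (at 0 within {0..h0})"
    by (rule DERIV_cmult[OF D']) (use h0 in simp)
  hence "((\<lambda>t. s * D t) has_real_derivative kuramoto_delta n P \<gamma> \<theta>0) (at 0 within {0..h0})"
    by (simp add: mult.assoc[symmetric] s c0 kuramoto_delta_def)
  then obtain d where d: "d > 0" "\<And>t. t > 0 \<Longrightarrow> 0 + t \<in> {0..h0} \<Longrightarrow> t < d \<Longrightarrow> s * D 0 > s * D (0 + t)"
    using has_real_derivative_neg_dec_right[OF _ delta] by blast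
  \<comment> \<open>Half of \<open>d\<close> keeps the closed interval \<open>{0..h}\<close> within
    t < d, where the sign is known.\<close>
  define h where "h = min h0 (d / 2)"
  have h: "h > 0" "h \<le> h0" using h0 d(1) by (auto simp: h_def)
  have sub: "{0..h} \<subseteq> {0..h0}" using h by auto
  have neg: "s * D t < 0" if "0 < t" "t \<le> h" for t
    using d(2)[of t] that d(1) det0 c0 by (auto simp: h_def D_def)
  define G where "G t = integral {0..t} (\<lambda>t. s * D t)" for t
  have contD: "continuous_on {0..h} (\<lambda>t. s * D t)"
  proof (intro continuous_intros)
    have "continuous_on {0..h0} D"
      by (rule DERIV_continuous_on) (rule D')
    thus "continuous_on {0..h} D" using sub by (rule continuous_on_subset)
  qed
  have G': "(G has_real_derivative s * D t) (at t within {0..h})" if "t \<in> {0..h}" for t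
    unfolding G_def by (rule integral_has_real_derivative[OF contD that])
  have G0: "G 0 = 0" by (simp add: G_def)
  define \<sigma> where "\<sigma> t = \<sigma>0 * exp (G t)" for t
  have \<sigma>': "(\<sigma> has_real_derivative \<sigma>0 * (exp (G t) * (s * D t))) (at t within {0..h})" if "t \<in> {0..h}" for t
    unfolding \<sigma>_def by (rule DERIV_cmult) (use DERIV_chain'[OF G'[OF that] DERIV_exp] in simp)
  have cont\<sigma>: "continuous_on {0..h} \<sigma>"
    by (rule DERIV_continuous_on) (rule \<sigma>')
  have locked: "\<sigma> t \<cdot>\<^sub>v kuramoto_g n \<gamma> (c t) = \<omega>" if t: "t \<in> {0..h}" for t
  proof (rule eq_vecI)
    fix i assume "i < dim_vec \<omega>"
    hence i: "i < n" by (simp add: \<omega> kuramoto_g_def)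
    define \<phi> where "\<phi> t = exp (G t) * kuramoto_g n \<gamma> (c t) $ i" for t
    have "(\<phi> has_real_derivative 0) (at t within {0..h})" if t: "t \<in> {0..h}" for t
    proof -
      have v: "v_field n P \<gamma> (c t) \<in> carrier_vec n"
        using trigpoly_v_field[OF P] by (simp add: trigpoly_vec_def)
      have c'': "((\<lambda>t. c t $ k) has_real_derivative (s \<cdot>\<^sub>v v_field n P \<gamma> (c t)) $ k) (at t within {0..h})"
        if k: "k < n" for k
        using DERIV_subset[OF c'[OF subsetD[OF sub t] k] sub] k v by simp
      have "(kuramoto_jacobian n \<gamma> (c t) *\<^sub>v (s \<cdot>\<^sub>v v_field n P \<gamma> (c t))) $ i = s * (- D t * kuramoto_g n \<gamma> (c t) $ i)"
        unfolding mult_mat_vec[OF kuramoto_jacobian_carrier v] kuramoto_jacobian_v_field[OF onb c]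
        using i kuramoto_g_carrier[of n \<gamma> "c t"] by (simp add: D_def)
      with kuramoto_g_chain[OF c'' smult_carrier_vec[THEN iffD2, OF v] i, of \<gamma>]
      have g': "((\<lambda>t. kuramoto_g n \<gamma> (c t) $ i) has_real_derivative s * (- D t * kuramoto_g n \<gamma> (c t) $ i)) (at t within {0..h})"
        by simp
      have "((\<lambda>t. exp (G t)) has_real_derivative exp (G t) * (s * D t)) (at t within {0..h})"
        by (rule DERIV_chain'[OF G'[OF t] DERIV_exp])
      from DERIV_mult[OF this g'] show ?thesis unfolding \<phi>_def by (simp add: algebra_simps)
    qed
    hence "\<exists>k. \<forall>t\<in>{0..h}. \<phi> t = k"
      by (intro has_field_derivative_zero_constant) auto
    hence "\<phi> t = \<phi> 0" using t h(1) by auto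
    hence "exp (G t) * kuramoto_g n \<gamma> (c t) $ i = kuramoto_g n \<gamma> \<theta>0 $ i" by (simp add: \<phi>_def G0 c0)
    thus "(\<sigma> t \<cdot>\<^sub>v kuramoto_g n \<gamma> (c t)) $ i = \<omega> $ i"
      using i kuramoto_g_carrier[of n \<gamma> "c t"] kuramoto_g_carrier[of n \<gamma> \<theta>0]
      by (simp add: \<sigma>_def \<omega> mult.assoc)
  qed (simp add: \<omega> kuramoto_g_def)
  \<comment> \<open>Only the open interval needs a negative derivative; at time 0 the derivative
    vanishes together with det_Red.\<close>
  have dec: "\<sigma> b < \<sigma> a" if ab: "0 \<le> a" "a < b" "b \<le> h" for a b
  proof (rule DERIV_neg_imp_decreasing_open[OF ab(2)])
    fix t assume t: "a < t" "t < b"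
    hence "(\<sigma> has_real_derivative \<sigma>0 * (exp (G t) * (s * D t))) (at t)"
      using \<sigma>'[of t] ab at_within_Icc_at[of 0 t h] by simp
    moreover have "\<sigma>0 * (exp (G t) * (s * D t)) < 0"
      by (intro mult_pos_neg[OF \<sigma>0] mult_pos_neg[OF exp_gt_zero] neg) (use t ab in auto)
    ultimately show "\<exists>y. DERIV \<sigma> t :> y \<and> y < 0" by blast
  next
    show "continuous_on {a..b} \<sigma>" by (rule continuous_on_subset[OF cont\<sigma>]) (use ab in auto)
  qed
  have \<sigma>at0: "\<sigma> 0 = \<sigma>0" by (simp add: \<sigma>_def G0)
  obtain T where T: "continuous_on {\<sigma> h..\<sigma>0} T" "T ` {\<sigma> h..\<sigma>0} \<subseteq> {0..h}" "T \<sigma>0 = 0"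
    "\<And>y. y \<in> {\<sigma> h..\<sigma>0} \<Longrightarrow> \<sigma> (T y) = y"
    using strict_decreasing_inverse[OF h(1) cont\<sigma> dec] unfolding \<sigma>at0 by blast
  define \<epsilon> where "\<epsilon> = \<sigma>0 - \<sigma> h"
  have \<epsilon>: "\<epsilon> > 0" "\<sigma>0 - \<epsilon> = \<sigma> h" using dec[of 0 h] h(1) \<sigma>at0 by (auto simp: \<epsilon>_def)
  show thesis
  proof (rule that[of \<epsilon> "\<lambda>y. c (T y)"])
    show "\<epsilon> > 0" by fact
    fix i assume i: "i < n"
    have "continuous_on {0..h0} (\<lambda>t. c t $ i)"
      by (rule DERIV_continuous_on) (rule c'[OF _ i])
    hence "continuous_on {0..h} (\<lambda>t. c t $ i)" using sub by (rule continuous_on_subset)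
    thus "continuous_on {\<sigma>0 - \<epsilon>..\<sigma>0} (\<lambda>\<sigma>. c (T \<sigma>) $ i)"
      unfolding \<epsilon>(2) by (rule continuous_on_compose2[OF _ T(1,2)])
  next
    fix y assume y: "y \<in> {\<sigma>0 - \<epsilon>..\<sigma>0}"
    hence "T y \<in> {0..h}" using T(2) unfolding \<epsilon>(2) by blast
    from locked[OF this] show "phase_locked n \<omega> \<gamma> y (c (T y))"
      using T(4)[of y] y c unfolding \<epsilon>(2) phase_locked_def by simp
  next
    show "c (T \<sigma>0) = \<theta>0" by (simp add: T(3) c0)
  next
    fix y assume y: "y \<in> {\<sigma>0 - \<epsilon>..<\<sigma>0}"
    hence y': "y \<in> {\<sigma> h..\<sigma>0}" unfolding \<epsilon>(2) by auto
    hence "T y \<in> {0..h}" using T(2) by blast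
    moreover have "T y \<noteq> 0" using T(4)[OF y'] y \<sigma>at0 by auto
    ultimately show "s * det_red P (kuramoto_jacobian n \<gamma> (c (T y))) < 0"
      using neg[of "T y"] by (auto simp: D_def)
  qed
qed

section \<open>Eigenvalue counts along the branches\<close>

lemma eventually_num_pos_cos_eq:
  fixes \<sigma>0 \<epsilon> :: real
  assumes \<epsilon>: "\<epsilon> > 0" and cont: "\<forall>i<n. continuous_on {\<sigma>0 - \<epsilon>..\<sigma>0} (\<lambda>\<sigma>. \<theta> \<sigma> $ i)"
    and cos: "\<forall>i<n. cos (angle_diff n (\<theta> \<sigma>0) $ i) \<noteq> 0"
  shows "\<forall>\<^sub>F \<sigma> in at_left \<sigma>0. (\<forall>i<n. cos (angle_diff n (\<theta> \<sigma>) $ i) \<noteq> 0) \<and>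
    num_pos_cos n (\<theta> \<sigma>) = num_pos_cos n (\<theta> \<sigma>0)"
proof -
  \<comment> \<open>A cosine that is continuous up to \<sigma>0 and nonzero there keeps its sign
    just to the left; finitely many such statements combine.\<close>
  have "\<forall>\<^sub>F \<sigma> in at_left \<sigma>0. cos (angle_diff n (\<theta> \<sigma>) $ i) \<noteq> 0 \<and>
      (cos (angle_diff n (\<theta> \<sigma>) $ i) > 0 \<longleftrightarrow> cos (angle_diff n (\<theta> \<sigma>0) $ i) > 0)" if i: "i < n" for i
  proof -
    have "continuous_on {\<sigma>0 - \<epsilon>..\<sigma>0} (\<lambda>\<sigma>. cos (angle_diff n (\<theta> \<sigma>) $ i))"
      unfolding angle_diff_index[OF i] by (intro continuous_intros cont[rule_format] i cyclic_succ_pred(1)[OF i])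
    hence "((\<lambda>\<sigma>. cos (angle_diff n (\<theta> \<sigma>) $ i)) \<longlongrightarrow> cos (angle_diff n (\<theta> \<sigma>0) $ i)) (at \<sigma>0 within {\<sigma>0 - \<epsilon>..\<sigma>0})"
      using \<epsilon> by (simp add: continuous_on_def)
    hence lim: "((\<lambda>\<sigma>. cos (angle_diff n (\<theta> \<sigma>) $ i)) \<longlongrightarrow> cos (angle_diff n (\<theta> \<sigma>0) $ i)) (at_left \<sigma>0)"
      using \<epsilon> by (simp add: at_within_Icc_at_left)
    consider "cos (angle_diff n (\<theta> \<sigma>0) $ i) > 0" | "cos (angle_diff n (\<theta> \<sigma>0) $ i) < 0"
      using cos i by force
    thus ?thesis
    proof cases
      case 1
      from order_tendstoD(1)[OF lim 1] show ?thesis by eventually_elim (use 1 in auto)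
    next
      case 2
      from order_tendstoD(2)[OF lim 2] show ?thesis by eventually_elim (use 2 in auto)
    qed
  qed
  hence "\<forall>\<^sub>F \<sigma> in at_left \<sigma>0. \<forall>i\<in>{..<n}. cos (angle_diff n (\<theta> \<sigma>) $ i) \<noteq> 0 \<and>
      (cos (angle_diff n (\<theta> \<sigma>) $ i) > 0 \<longleftrightarrow> cos (angle_diff n (\<theta> \<sigma>0) $ i) > 0)"
    by (intro eventually_ball_finite) auto
  thus ?thesis
  proof eventually_elim
    case (elim \<sigma>)
    hence "{i. i < n \<and> cos (angle_diff n (\<theta> \<sigma>) $ i) > 0} = {i. i < n \<and> cos (angle_diff n (\<theta> \<sigma>0) $ i) > 0}"
      by auto
    thus ?case using elim by (simp add: num_pos_cos_def)
  qed
qed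

lemma eigenvector_ones:
  assumes "\<theta> \<in> carrier_vec n" "n \<ge> 1"
  shows "eigenvector (kuramoto_jacobian n \<gamma> \<theta>) (ones n) 0"
proof -
  have "ones n $ 0 \<noteq> 0\<^sub>v n $ 0" using assms(2) by (simp add: ones_def)
  hence "ones n \<noteq> 0\<^sub>v n" by metis
  moreover have "0\<^sub>v n = 0 \<cdot>\<^sub>v ones n" by (rule eq_vecI) (auto simp: ones_def)
  ultimately show ?thesis
    unfolding eigenvector_def using kuramoto_jacobian_ones[OF assms(1)] ones_carrier[of n]
      kuramoto_jacobian_carrier[of n \<gamma> \<theta>] by auto
qed

lemma stable_point_if_pos:
  assumes \<theta>: "\<theta> \<in> carrier_vec n" and n: "n \<ge> 1"
    and E: "real_eigenvalues (kuramoto_jacobian n \<gamma> \<theta>) = add_mset 0 E"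
    and size: "size {#x \<in># E. x > 0#} = size E"
  shows "stable_point n \<gamma> \<theta>"
proof -
  have part: "E = {#x \<in># E. x > 0#} + {#x \<in># E. \<not> x > 0#}" by (rule multiset_partition)
  have "size E = size {#x \<in># E. x > 0#} + size {#x \<in># E. \<not> x > 0#}"
    using arg_cong[OF part, of size] by (simp only: size_union)
  hence "size {#x \<in># E. \<not> x > 0#} = 0" using size by linarith
  hence none: "{#x \<in># E. \<not> x > 0#} = {#}" by (simp only: size_eq_0_iff_empty)
  have "\<forall>x \<in># E. x > 0"
  proof (rule ballI, rule ccontr)
    fix x assume "x \<in># E" "\<not> x > 0"
    hence "x \<in># {#x \<in># E. \<not> x > 0#}" by simp
    thus False unfolding none by simp
  qed
  thus ?thesis unfolding stable_point_def E using eigenvector_ones[OF \<theta> n] by simp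
qed

text \<open>The size condition leaves a single element of \<open>E\<close> that is not positive, and
  because 0 is not in \<open>E\<close> it is strictly negative.\<close>

lemma one_saddle_if_pos:
  assumes \<theta>: "\<theta> \<in> carrier_vec n" and n: "n \<ge> 1"
    and E: "real_eigenvalues (kuramoto_jacobian n \<gamma> \<theta>) = add_mset 0 E" "0 \<notin># E"
    and size: "size {#x \<in># E. x > 0#} + 1 = size E"
  shows "one_saddle n \<gamma> \<theta>"
proof -
  have part: "E = {#x \<in># E. x > 0#} + {#x \<in># E. \<not> x > 0#}" by (rule multiset_partition)
  have "size E = size {#x \<in># E. x > 0#} + size {#x \<in># E. \<not> x > 0#}"
    using arg_cong[OF part, of size] by (simp only: size_union)
  hence "size {#x \<in># E. \<not> x > 0#} = 1" using size by linarith
  from size_1_singleton_mset[OF this] obtain \<mu> where \<mu>: "{#x \<in># E. \<not> x > 0#} = {#\<mu>#}" ..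
  hence "\<mu> \<in># {#x \<in># E. \<not> x > 0#}" by simp
  hence "\<mu> \<in># E" "\<not> \<mu> > 0" by auto
  moreover have "\<mu> \<noteq> 0" using \<open>\<mu> \<in># E\<close> E(2) by auto
  moreover have "E - {#\<mu>#} = {#x \<in># E. x > 0#}" 
    using arg_cong[OF part[unfolded \<mu>], of "\<lambda>M. M - {#\<mu>#}"] by (simp only: add_diff_cancel_right')
  hence "\<forall>x \<in># E - {#\<mu>#}. x > 0" by simp
  ultimately show ?thesis
    unfolding one_saddle_def E using eigenvector_ones[OF \<theta> n] by (auto intro!: bexI[of _ \<mu>])
qed

lemma kuramoto_branch_eigenvalues:
  fixes \<sigma>0 \<epsilon> :: real
  assumes n: "n \<ge> 1" and onb: "onb_ones_perp n P" and \<gamma>: "\<forall>i<n. \<gamma> $ i > 0" and \<epsilon>: "\<epsilon> > 0"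
    and cont: "\<forall>i<n. continuous_on {\<sigma>0 - \<epsilon>..\<sigma>0} (\<lambda>\<sigma>. \<theta> \<sigma> $ i)"
    and carrier: "\<forall>\<sigma>\<in>{\<sigma>0 - \<epsilon>..\<sigma>0}. \<theta> \<sigma> \<in> carrier_vec n"
    and det: "\<forall>\<sigma>\<in>{\<sigma>0 - \<epsilon>..<\<sigma>0}. det_red P (kuramoto_jacobian n \<gamma> (\<theta> \<sigma>)) \<noteq> 0"
    and cos: "\<forall>i<n. cos (angle_diff n (\<theta> \<sigma>0) $ i) \<noteq> 0"
  shows "\<forall>\<^sub>F \<sigma> in at_left \<sigma>0.
    (let d = (- 1) ^ (n - num_pos_cos n (\<theta> \<sigma>0)) * det_red P (kuramoto_jacobian n \<gamma> (\<theta> \<sigma>));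
         k = int (num_pos_eigenvalues (kuramoto_jacobian n \<gamma> (\<theta> \<sigma>)))
     in (d > 0 \<longrightarrow> k = int (num_pos_cos n (\<theta> \<sigma>0)) - 1) \<and> (d < 0 \<longrightarrow> k = int (num_pos_cos n (\<theta> \<sigma>0))))"
    and "num_pos_cos n (\<theta> \<sigma>0) = n - 1 \<Longrightarrow> \<forall>\<^sub>F \<sigma> in at_left \<sigma>0.
      (det_red P (kuramoto_jacobian n \<gamma> (\<theta> \<sigma>)) > 0 \<longrightarrow> stable_point n \<gamma> (\<theta> \<sigma>)) \<and>
      (det_red P (kuramoto_jacobian n \<gamma> (\<theta> \<sigma>)) < 0 \<longrightarrow> one_saddle n \<gamma> (\<theta> \<sigma>))"
proof -
  let ?k = "num_pos_cos n (\<theta> \<sigma>0)"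
  \<comment> \<open>All facts about the remaining spectrum \<open>E\<close> are bundled, so that one
    eventual statement feeds both conclusions.\<close>
  define Q where "Q \<sigma> E \<longleftrightarrow> real_eigenvalues (kuramoto_jacobian n \<gamma> (\<theta> \<sigma>)) = add_mset 0 E \<and> 0 \<notin># E \<and> size E = n - 1 \<and>
    num_pos_eigenvalues (kuramoto_jacobian n \<gamma> (\<theta> \<sigma>)) = size {#x \<in># E. x > 0#} \<and>
    ((- 1) ^ (n - ?k) * det_red P (kuramoto_jacobian n \<gamma> (\<theta> \<sigma>)) > 0 \<longrightarrow> size {#x \<in># E. x > 0#} + 1 = ?k) \<and>
    ((- 1) ^ (n - ?k) * det_red P (kuramoto_jacobian n \<gamma> (\<theta> \<sigma>)) < 0 \<longrightarrow> size {#x \<in># E. x > 0#} = ?k) \<and>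
    \<theta> \<sigma> \<in> carrier_vec n" for \<sigma> E
  have "\<forall>\<^sub>F \<sigma> in at_left \<sigma>0. \<sigma> \<in> {\<sigma>0 - \<epsilon><..<\<sigma>0}"
    using \<epsilon> by (intro eventually_at_left_real) simp
  hence ev: "\<forall>\<^sub>F \<sigma> in at_left \<sigma>0. \<exists>E. Q \<sigma> E"
    using eventually_num_pos_cos_eq[OF \<epsilon> cont cos]
  proof eventually_elim
    case (elim \<sigma>)
    have c: "\<theta> \<sigma> \<in> carrier_vec n" using elim(1) carrier by simp
    have d: "det_red P (kuramoto_jacobian n \<gamma> (\<theta> \<sigma>)) \<noteq> 0" using elim(1) det by simp
    have cs: "\<forall>i<n. cos (angle_diff n (\<theta> \<sigma>) $ i) \<noteq> 0" and k: "num_pos_cos n (\<theta> \<sigma>) = ?k"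
      using elim(2) by auto
    show ?case
    proof (rule kuramoto_eigenvalues[OF n onb c \<gamma> cs d], unfold k)
      fix E
      assume "real_eigenvalues (kuramoto_jacobian n \<gamma> (\<theta> \<sigma>)) = add_mset 0 E" "0 \<notin># E" "size E = n - 1"
        "num_pos_eigenvalues (kuramoto_jacobian n \<gamma> (\<theta> \<sigma>)) = size {#x \<in># E. x > 0#}"
        "0 < (- 1) ^ (n - ?k) * det_red P (kuramoto_jacobian n \<gamma> (\<theta> \<sigma>)) \<Longrightarrow>
          size {#x \<in># E. x > 0#} + 1 = ?k"
        "(- 1) ^ (n - ?k) * det_red P (kuramoto_jacobian n \<gamma> (\<theta> \<sigma>)) < 0 \<Longrightarrow>
          size {#x \<in># E. x > 0#} = ?k"
      hence "Q \<sigma> E" using c unfolding Q_def by blast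
      thus "\<exists>E. Q \<sigma> E" ..
    qed
  qed
  from ev show "\<forall>\<^sub>F \<sigma> in at_left \<sigma>0.
    (let d = (- 1) ^ (n - ?k) * det_red P (kuramoto_jacobian n \<gamma> (\<theta> \<sigma>));
         k = int (num_pos_eigenvalues (kuramoto_jacobian n \<gamma> (\<theta> \<sigma>)))
     in (d > 0 \<longrightarrow> k = int ?k - 1) \<and> (d < 0 \<longrightarrow> k = int ?k))"
  proof eventually_elim
    case (elim \<sigma>)
    then obtain E where "Q \<sigma> E" ..
    thus ?case unfolding Q_def Let_def by auto
  qed
  assume k: "?k = n - 1"
  \<comment> \<open>The sign factor is now -1: a positive reduced determinant makes all n - 1
    remaining eigenvalues positive, a negative one leaves n - 2 of them positive.\<close>
  have nk: "n - ?k = 1" using k n by simp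
  from ev show "\<forall>\<^sub>F \<sigma> in at_left \<sigma>0.
      (det_red P (kuramoto_jacobian n \<gamma> (\<theta> \<sigma>)) > 0 \<longrightarrow> stable_point n \<gamma> (\<theta> \<sigma>)) \<and>
      (det_red P (kuramoto_jacobian n \<gamma> (\<theta> \<sigma>)) < 0 \<longrightarrow> one_saddle n \<gamma> (\<theta> \<sigma>))"
  proof eventually_elim
    case (elim \<sigma>)
    then obtain E where Q: "Q \<sigma> E" ..
    show ?case
    proof (intro conjI impI)
      assume "det_red P (kuramoto_jacobian n \<gamma> (\<theta> \<sigma>)) > 0"
      hence "size {#x \<in># E. x > 0#} = size E" using Q unfolding Q_def nk by (simp add: k)
      thus "stable_point n \<gamma> (\<theta> \<sigma>)" using Q n unfolding Q_def by (intro stable_point_if_pos[of _ n \<gamma> E]) auto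
    next
      assume "det_red P (kuramoto_jacobian n \<gamma> (\<theta> \<sigma>)) < 0"
      hence "size {#x \<in># E. x > 0#} + 1 = size E" using Q unfolding Q_def nk by (simp add: k)
      thus "one_saddle n \<gamma> (\<theta> \<sigma>)" using Q n unfolding Q_def by (intro one_saddle_if_pos[of _ n \<gamma> E]) auto
    qed
  qed
qed

theorem theorem2:
  fixes n :: nat
    and P :: "real Matrix.mat"
    and \<theta>0 \<gamma> \<omega> :: "real Matrix.vec"
    and \<sigma>0 :: real
  assumes "n \<ge> 3"
    and "onb_ones_perp n P"
    and "\<theta>0 \<in> carrier_vec n"
    and "\<gamma> \<in> carrier_vec n"
    and "\<forall>i<n. vec_index \<gamma> i > 0"
    and "det_red P (kuramoto_jacobian n \<gamma> \<theta>0) = 0"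
    and "kuramoto_delta n P \<gamma> \<theta>0 < 0"
    and "\<sigma>0 > 0"
    and "\<omega> = smult_vec \<sigma>0 (kuramoto_g n \<gamma> \<theta>0)"
  shows "\<exists>\<epsilon> \<theta>1 \<theta>2.
    colliding_branches n P \<omega> \<gamma> \<theta>0 \<sigma>0 \<epsilon> \<theta>1 \<theta>2 \<and>
    (\<forall>\<^sub>F \<sigma> in at_left \<sigma>0. det_red P (kuramoto_jacobian n \<gamma> (\<theta>1 \<sigma>)) > 0) \<and>
    (\<forall>\<^sub>F \<sigma> in at_left \<sigma>0. det_red P (kuramoto_jacobian n \<gamma> (\<theta>2 \<sigma>)) < 0) \<and>
    ((\<forall>i<n. cos (vec_index (angle_diff n \<theta>0) i) \<noteq> 0) \<longrightarrow>
       (\<forall>\<theta>\<in>{\<theta>1, \<theta>2}. \<forall>\<^sub>F \<sigma> in at_left \<sigma>0.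
          (let d = (- 1) ^ (n - num_pos_cos n \<theta>0) * det_red P (kuramoto_jacobian n \<gamma> (\<theta> \<sigma>));
               k = int (num_pos_eigenvalues (kuramoto_jacobian n \<gamma> (\<theta> \<sigma>)))
           in (d > 0 \<longrightarrow> k = int (num_pos_cos n \<theta>0) - 1) \<and>
              (d < 0 \<longrightarrow> k = int (num_pos_cos n \<theta>0)))) \<and>
       (num_pos_cos n \<theta>0 = n - 1 \<longrightarrow>
          (\<forall>\<^sub>F \<sigma> in at_left \<sigma>0. stable_point n \<gamma> (\<theta>1 \<sigma>)) \<and>
            (\<forall>\<^sub>F \<sigma> in at_left \<sigma>0. one_saddle n \<gamma> (\<theta>2 \<sigma>)) \<or>
          (\<forall>\<^sub>F \<sigma> in at_left \<sigma>0. stable_point n \<gamma> (\<theta>2 \<sigma>)) \<and>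
            (\<forall>\<^sub>F \<sigma> in at_left \<sigma>0. one_saddle n \<gamma> (\<theta>1 \<sigma>))))"
proof -
  note branch = kuramoto_branch[OF assms(2,3,6-9)]
  obtain \<epsilon>1 \<theta>1 where b1: "\<epsilon>1 > 0"
    "\<And>i. i < n \<Longrightarrow> continuous_on {\<sigma>0 - \<epsilon>1..\<sigma>0} (\<lambda>\<sigma>. \<theta>1 \<sigma> $ i)"
    "\<And>\<sigma>. \<sigma> \<in> {\<sigma>0 - \<epsilon>1..\<sigma>0} \<Longrightarrow> phase_locked n \<omega> \<gamma> \<sigma> (\<theta>1 \<sigma>)"
    "\<theta>1 \<sigma>0 = \<theta>0"
    "\<And>\<sigma>. \<sigma> \<in> {\<sigma>0 - \<epsilon>1..<\<sigma>0} \<Longrightarrow> - 1 * det_red P (kuramoto_jacobian n \<gamma> (\<theta>1 \<sigma>)) < 0"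
    by (rule branch[of "- 1"]) (simp, rule that)
  obtain \<epsilon>2 \<theta>2 where b2: "\<epsilon>2 > 0"
    "\<And>i. i < n \<Longrightarrow> continuous_on {\<sigma>0 - \<epsilon>2..\<sigma>0} (\<lambda>\<sigma>. \<theta>2 \<sigma> $ i)"
    "\<And>\<sigma>. \<sigma> \<in> {\<sigma>0 - \<epsilon>2..\<sigma>0} \<Longrightarrow> phase_locked n \<omega> \<gamma> \<sigma> (\<theta>2 \<sigma>)"
    "\<theta>2 \<sigma>0 = \<theta>0"
    "\<And>\<sigma>. \<sigma> \<in> {\<sigma>0 - \<epsilon>2..<\<sigma>0} \<Longrightarrow> 1 * det_red P (kuramoto_jacobian n \<gamma> (\<theta>2 \<sigma>)) < 0"
    by (rule branch[of 1]) (simp, rule that)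
  define \<epsilon> where "\<epsilon> = min \<epsilon>1 \<epsilon>2"
  have \<epsilon>: "\<epsilon> > 0" "\<epsilon> \<le> \<epsilon>1" "\<epsilon> \<le> \<epsilon>2" using b1(1) b2(1) by (auto simp: \<epsilon>_def)
  have sub: "{\<sigma>0 - \<epsilon>..\<sigma>0} \<subseteq> {\<sigma>0 - \<epsilon>1..\<sigma>0}" "{\<sigma>0 - \<epsilon>..\<sigma>0} \<subseteq> {\<sigma>0 - \<epsilon>2..\<sigma>0}" using \<epsilon> by auto
  have cont: "continuous_on {\<sigma>0 - \<epsilon>..\<sigma>0} (\<lambda>\<sigma>. \<theta>1 \<sigma> $ i)" "continuous_on {\<sigma>0 - \<epsilon>..\<sigma>0} (\<lambda>\<sigma>. \<theta>2 \<sigma> $ i)"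
    if "i < n" for i
    by (rule continuous_on_subset[OF b1(2)[OF that] sub(1)], rule continuous_on_subset[OF b2(2)[OF that] sub(2)])
  have pl: "phase_locked n \<omega> \<gamma> \<sigma> (\<theta>1 \<sigma>)" "phase_locked n \<omega> \<gamma> \<sigma> (\<theta>2 \<sigma>)" if "\<sigma> \<in> {\<sigma>0 - \<epsilon>..\<sigma>0}" for \<sigma>
    using b1(3) b2(3) that sub by blast+
  have car: "\<theta>1 \<sigma> \<in> carrier_vec n" "\<theta>2 \<sigma> \<in> carrier_vec n" if "\<sigma> \<in> {\<sigma>0 - \<epsilon>..\<sigma>0}" for \<sigma>
    using pl[OF that] by (simp_all add: phase_locked_def)
  have det: "det_red P (kuramoto_jacobian n \<gamma> (\<theta>1 \<sigma>)) > 0" "det_red P (kuramoto_jacobian n \<gamma> (\<theta>2 \<sigma>)) < 0"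
    if "\<sigma> \<in> {\<sigma>0 - \<epsilon>..<\<sigma>0}" for \<sigma>
    using b1(5)[of \<sigma>] b2(5)[of \<sigma>] that \<epsilon> by auto
  have distinct: "\<not> (\<exists>c. \<theta>1 \<sigma> - \<theta>2 \<sigma> = c \<cdot>\<^sub>v ones n)" if \<sigma>: "\<sigma> \<in> {\<sigma>0 - \<epsilon><..<\<sigma>0}" for \<sigma>
  proof
    assume "\<exists>c. \<theta>1 \<sigma> - \<theta>2 \<sigma> = c \<cdot>\<^sub>v ones n"
    then obtain c where "\<theta>1 \<sigma> - \<theta>2 \<sigma> = c \<cdot>\<^sub>v ones n" ..
    hence "kuramoto_jacobian n \<gamma> (\<theta>1 \<sigma>) = kuramoto_jacobian n \<gamma> (\<theta>2 \<sigma>)"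
      using car[of \<sigma>] \<sigma> by (intro kuramoto_jacobian_shift[of _ n _ c]) auto
    thus False using det[of \<sigma>] \<sigma> by auto
  qed
  have sub': "{\<sigma>0 - \<epsilon><..\<sigma>0} \<subseteq> {\<sigma>0 - \<epsilon>..\<sigma>0}" by auto
  have colliding: "colliding_branches n P \<omega> \<gamma> \<theta>0 \<sigma>0 \<epsilon> \<theta>1 \<theta>2"
    unfolding colliding_branches_def
  proof (intro conjI ballI allI impI)
    show "\<epsilon> > 0" by (rule \<epsilon>(1))
    show "\<not> (\<exists>c. \<theta>1 \<sigma> - \<theta>2 \<sigma> = c \<cdot>\<^sub>v ones n)" if "\<sigma> \<in> {\<sigma>0 - \<epsilon><..<\<sigma>0}" for \<sigma> by (rule distinct[OF that])
    fix \<theta> assume \<theta>: "\<theta> \<in> {\<theta>1, \<theta>2}"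
    show "\<theta> \<sigma>0 = \<theta>0" using \<theta> b1(4) b2(4) by auto
    show "continuous_on {\<sigma>0 - \<epsilon><..\<sigma>0} (\<lambda>\<sigma>. \<theta> \<sigma> $ i)" if "i < n" for i
      using \<theta> continuous_on_subset[OF cont(1)[OF that] sub'] continuous_on_subset[OF cont(2)[OF that] sub'] by auto
    show "phase_locked n \<omega> \<gamma> \<sigma> (\<theta> \<sigma>)" if "\<sigma> \<in> {\<sigma>0 - \<epsilon><..\<sigma>0}" for \<sigma>
      using \<theta> pl[OF subsetD[OF sub' that]] by auto
    show "det_red P (kuramoto_jacobian n \<gamma> (\<theta> \<sigma>)) \<noteq> 0" if "\<sigma> \<in> {\<sigma>0 - \<epsilon><..<\<sigma>0}" for \<sigma>
      using \<theta> det[of \<sigma>] that by auto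
  qed
  have near: "\<forall>\<^sub>F \<sigma> in at_left \<sigma>0. \<sigma> \<in> {\<sigma>0 - \<epsilon><..<\<sigma>0}"
    using \<epsilon>(1) by (intro eventually_at_left_real) simp
  have ev1: "\<forall>\<^sub>F \<sigma> in at_left \<sigma>0. det_red P (kuramoto_jacobian n \<gamma> (\<theta>1 \<sigma>)) > 0"
    using near by eventually_elim (rule det(1), simp)
  have ev2: "\<forall>\<^sub>F \<sigma> in at_left \<sigma>0. det_red P (kuramoto_jacobian n \<gamma> (\<theta>2 \<sigma>)) < 0"
    using near by eventually_elim (rule det(2), simp)
  have n: "n \<ge> 1" using assms(1) by simp
  have nz: "det_red P (kuramoto_jacobian n \<gamma> (\<theta>1 \<sigma>)) \<noteq> 0" "det_red P (kuramoto_jacobian n \<gamma> (\<theta>2 \<sigma>)) \<noteq> 0"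
    if "\<sigma> \<in> {\<sigma>0 - \<epsilon>..<\<sigma>0}" for \<sigma>
    using det[OF that] by simp_all
  show ?thesis
  proof (rule exI[of _ \<epsilon>], rule exI[of _ \<theta>1], rule exI[of _ \<theta>2], intro conjI impI)
    show "colliding_branches n P \<omega> \<gamma> \<theta>0 \<sigma>0 \<epsilon> \<theta>1 \<theta>2" by (rule colliding)
    show "\<forall>\<^sub>F \<sigma> in at_left \<sigma>0. det_red P (kuramoto_jacobian n \<gamma> (\<theta>1 \<sigma>)) > 0" by (rule ev1)
    show "\<forall>\<^sub>F \<sigma> in at_left \<sigma>0. det_red P (kuramoto_jacobian n \<gamma> (\<theta>2 \<sigma>)) < 0" by (rule ev2)
    assume cos: "\<forall>i<n. cos (angle_diff n \<theta>0 $ i) \<noteq> 0"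
    have p1: "\<forall>i<n. continuous_on {\<sigma>0 - \<epsilon>..\<sigma>0} (\<lambda>\<sigma>. \<theta>1 \<sigma> $ i)"
      "\<forall>\<sigma>\<in>{\<sigma>0 - \<epsilon>..\<sigma>0}. \<theta>1 \<sigma> \<in> carrier_vec n"
      "\<forall>\<sigma>\<in>{\<sigma>0 - \<epsilon>..<\<sigma>0}. det_red P (kuramoto_jacobian n \<gamma> (\<theta>1 \<sigma>)) \<noteq> 0"
      "\<forall>i<n. cos (angle_diff n (\<theta>1 \<sigma>0) $ i) \<noteq> 0"
      using cont(1) car(1) nz(1) cos b1(4) by simp_all
    have p2: "\<forall>i<n. continuous_on {\<sigma>0 - \<epsilon>..\<sigma>0} (\<lambda>\<sigma>. \<theta>2 \<sigma> $ i)"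
      "\<forall>\<sigma>\<in>{\<sigma>0 - \<epsilon>..\<sigma>0}. \<theta>2 \<sigma> \<in> carrier_vec n"
      "\<forall>\<sigma>\<in>{\<sigma>0 - \<epsilon>..<\<sigma>0}. det_red P (kuramoto_jacobian n \<gamma> (\<theta>2 \<sigma>)) \<noteq> 0"
      "\<forall>i<n. cos (angle_diff n (\<theta>2 \<sigma>0) $ i) \<noteq> 0"
      using cont(2) car(2) nz(2) cos b2(4) by simp_all
    note e1 = kuramoto_branch_eigenvalues[OF n assms(2,5) \<epsilon>(1) p1, unfolded b1(4)]
    note e2 = kuramoto_branch_eigenvalues[OF n assms(2,5) \<epsilon>(1) p2, unfolded b2(4)]
    show "\<forall>\<theta>\<in>{\<theta>1, \<theta>2}. \<forall>\<^sub>F \<sigma> in at_left \<sigma>0.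
          (let d = (- 1) ^ (n - num_pos_cos n \<theta>0) * det_red P (kuramoto_jacobian n \<gamma> (\<theta> \<sigma>));
               k = int (num_pos_eigenvalues (kuramoto_jacobian n \<gamma> (\<theta> \<sigma>)))
           in (d > 0 \<longrightarrow> k = int (num_pos_cos n \<theta>0) - 1) \<and>
              (d < 0 \<longrightarrow> k = int (num_pos_cos n \<theta>0)))"
    proof
      fix \<theta> assume "\<theta> \<in> {\<theta>1, \<theta>2}"
      then consider "\<theta> = \<theta>1" | "\<theta> = \<theta>2" by auto
      thus "\<forall>\<^sub>F \<sigma> in at_left \<sigma>0.
          (let d = (- 1) ^ (n - num_pos_cos n \<theta>0) * det_red P (kuramoto_jacobian n \<gamma> (\<theta> \<sigma>));
               k = int (num_pos_eigenvalues (kuramoto_jacobian n \<gamma> (\<theta> \<sigma>)))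
           in (d > 0 \<longrightarrow> k = int (num_pos_cos n \<theta>0) - 1) \<and>
              (d < 0 \<longrightarrow> k = int (num_pos_cos n \<theta>0)))"
      proof cases
        case 1
        show ?thesis unfolding 1 by (rule e1(1))
      next
        case 2
        show ?thesis unfolding 2 by (rule e2(1))
      qed
    qed
    assume k: "num_pos_cos n \<theta>0 = n - 1"
    \<comment> \<open>\<open>\<theta>1\<close> is the branch with positive reduced determinant,
      hence the stable one, and the first alternative holds.\<close>
    from e1(2)[OF k] ev1 have "\<forall>\<^sub>F \<sigma> in at_left \<sigma>0. stable_point n \<gamma> (\<theta>1 \<sigma>)"
      by eventually_elim simp
    moreover from e2(2)[OF k] ev2 have "\<forall>\<^sub>F \<sigma> in at_left \<sigma>0. one_saddle n \<gamma> (\<theta>2 \<sigma>)"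
      by eventually_elim simp
    ultimately show "(\<forall>\<^sub>F \<sigma> in at_left \<sigma>0. stable_point n \<gamma> (\<theta>1 \<sigma>)) \<and>
            (\<forall>\<^sub>F \<sigma> in at_left \<sigma>0. one_saddle n \<gamma> (\<theta>2 \<sigma>)) \<or>
          (\<forall>\<^sub>F \<sigma> in at_left \<sigma>0. stable_point n \<gamma> (\<theta>2 \<sigma>)) \<and>
            (\<forall>\<^sub>F \<sigma> in at_left \<sigma>0. one_saddle n \<gamma> (\<theta>1 \<sigma>))" by blast
  qed
qed

end
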